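(* For $k\in\{1,\dots,N\}$ let $(H_k)$ denote the statement: for every $F\in\tilde{\mathcal F}^k$ and every atom $\mathcal E$ of $\mathfrak A_k$, the induced subgraph $F|_{\mathcal E}$ is a tree. If $(H_k)$ holds for every $k\in\{1,\dots,N-1\}$ satisfying the strict inequality $\phi^{k-1}-\phi^k>\phi^k-\phi^{k+1}$, then $(H_k)$ holds for all $k\in\{1,\dots,N\}$.
   Context: $V$ is a digraph with vertex set $\mathcal N$, $|\mathcal N|=N$, real arc weights $v_{ij}$, having at least one spanning tree. An (entering) forest is a digraph in which every vertex has at most one outgoing arc and there is no directed cycle; its weakly connected components are trees. $\mathcal F^k$ is the set of spanning forests of $V$ with exactly $k$ trees; $\Upsilon^F$ is the total arc weight; $\phi^k=\min_{F\in\mathcal F^k}\Upsilon^F$, with $\phi^0=\infty$ (so $\infty-\phi^1$ exceeds any real number); $\tilde{\mathcal F}^k=\{F\in\mathcal F^k:\Upsilon^F=\phi^k\}$. It is known that $\phi^{k-1}-\phi^k\ge\phi^k-\phi^{k+1}$ for all $1\le k\le N-1$. $\mathfrak A_k$ is the algebra of subsets of $\mathcal N$ generated by the vertex sets of all trees of all forests in $\tilde{\mathcal F}^k$; atoms are its minimal nonempty elements. A single vertex with no arcs counts as a tree. *)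

theory Defs
  imports Main "HOL-Library.Extended_Real"
begin

text \<open>A digraph on a finite vertex set Vs with arc set A (a set of ordered pairs (i,j),
  meaning an arc from i to j). An (entering) forest on Vs: every vertex has at most one
  outgoing arc and there is no directed cycle.\<close>

definition is_forest :: "'a set \<Rightarrow> ('a \<times> 'a) set \<Rightarrow> bool" where
  "is_forest Vs A \<longleftrightarrow> A \<subseteq> Vs \<times> Vs
     \<and> (\<forall>x y z. (x, y) \<in> A \<longrightarrow> (x, z) \<in> A \<longrightarrow> y = z)
     \<and> acyclic A"

definition components :: "'a set \<Rightarrow> ('a \<times> 'a) set \<Rightarrow> 'a set set" where
  "components Vs A = Vs // {(x, y). x \<in> Vs \<and> y \<in> Vs \<and> (x, y) \<in> (A \<union> A\<inverse>)\<^sup>*}"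

definition is_tree :: "'a set \<Rightarrow> ('a \<times> 'a) set \<Rightarrow> bool" where
  "is_tree Vs A \<longleftrightarrow> is_forest Vs A \<and> card (components Vs A) = 1"

definition spanning_forests :: "'a set \<Rightarrow> ('a \<times> 'a) set \<Rightarrow> nat \<Rightarrow> ('a \<times> 'a) set set" where
  "spanning_forests Vs Arcs k =
     {F. F \<subseteq> Arcs \<and> is_forest Vs F \<and> card (components Vs F) = k}"

definition weight :: "('a \<Rightarrow> 'a \<Rightarrow> real) \<Rightarrow> ('a \<times> 'a) set \<Rightarrow> real" where
  "weight v F = (\<Sum>(i, j)\<in>F. v i j)"

definition phi :: "'a set \<Rightarrow> ('a \<times> 'a) set \<Rightarrow> ('a \<Rightarrow> 'a \<Rightarrow> real) \<Rightarrow> nat \<Rightarrow> ereal" where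
  "phi Vs Arcs v k =
     (if k = 0 then \<infinity> else ereal (Min (weight v ` spanning_forests Vs Arcs k)))"

definition min_forests :: "'a set \<Rightarrow> ('a \<times> 'a) set \<Rightarrow> ('a \<Rightarrow> 'a \<Rightarrow> real) \<Rightarrow> nat \<Rightarrow> ('a \<times> 'a) set set" where
  "min_forests Vs Arcs v k =
     {F \<in> spanning_forests Vs Arcs k. ereal (weight v F) = phi Vs Arcs v k}"

inductive_set gen_algebra :: "'a set \<Rightarrow> 'a set set \<Rightarrow> 'a set set" for \<Omega> G where
  basic: "A \<in> G \<Longrightarrow> A \<in> gen_algebra \<Omega> G"
| empty: "{} \<in> gen_algebra \<Omega> G"
| compl: "A \<in> gen_algebra \<Omega> G \<Longrightarrow> \<Omega> - A \<in> gen_algebra \<Omega> G"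
| union: "A \<in> gen_algebra \<Omega> G \<Longrightarrow> B \<in> gen_algebra \<Omega> G \<Longrightarrow> A \<union> B \<in> gen_algebra \<Omega> G"

definition is_atom :: "'a set set \<Rightarrow> 'a set \<Rightarrow> bool" where
  "is_atom M E \<longleftrightarrow> E \<in> M \<and> E \<noteq> {} \<and> (\<forall>B\<in>M. B \<subseteq> E \<longrightarrow> B = {} \<or> B = E)"

definition alg :: "'a set \<Rightarrow> ('a \<times> 'a) set \<Rightarrow> ('a \<Rightarrow> 'a \<Rightarrow> real) \<Rightarrow> nat \<Rightarrow> 'a set set" where
  "alg Vs Arcs v k = gen_algebra Vs (\<Union>F\<in>min_forests Vs Arcs v k. components Vs F)"

definition H :: "'a set \<Rightarrow> ('a \<times> 'a) set \<Rightarrow> ('a \<Rightarrow> 'a \<Rightarrow> real) \<Rightarrow> nat \<Rightarrow> bool" where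
  "H Vs Arcs v k \<longleftrightarrow>
     (\<forall>F\<in>min_forests Vs Arcs v k. \<forall>E. is_atom (alg Vs Arcs v k) E \<longrightarrow>
        is_tree E {(i, j). (i, j) \<in> F \<and> i \<in> E \<and> j \<in> E})"

end

theory Submission
  imports Defs
begin

text \<open>
  If the arcs leaving a vertex set A are swapped between two forests and both results are forests
  again, then total weight and total number of trees are preserved; so minimal forests yield minimal
  forests. Swapping on a tree of the finer forest that contains no root of the coarser one gives the
  convexity of the minimal weights, and also that every minimal k-forest is refined by a minimal
  (k+1)-forest. Hence the atoms at level k+1 refine those at level k.

  Add to the weight the slope at k times the number of roots; by convexity this cost is minimal on the
  minimal k- and (k+1)-forests. The bound persists for functional digraphs with cycles, provided no
  cycle stays inside an atom of level k+1: a minimal (k+1)-forest separating two vertices of the cycle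
  can be used to break it. So a swap may be used as soon as one of its two results is a forest and
  the other has no cycle inside an atom.

  Such swaps along paths and subtrees show that the atoms of levels k and k+1 coincide when the
  inequality at k is not strict, and that the atoms of level k+1 induce trees in the minimal
  k-forests once they induce trees in the minimal (k+1)-forests. The theorem follows by downward
  induction on k.
\<close>

section \<open>Forests and exchange of arcs\<close>

definition roots :: "'a set \<Rightarrow> ('a \<times> 'a) set \<Rightarrow> 'a set" where
  "roots V F = V - Domain F"

text \<open>Well defined when \<open>F\<close> is single-valued and the walk from \<open>x\<close>
  ends. If that walk runs into a cycle, the value is unspecified.\<close>

definition root_of :: "('a \<times> 'a) set \<Rightarrow> 'a \<Rightarrow> 'a" where
  "root_of F x = (THE r. (x, r) \<in> F\<^sup>* \<and> r \<notin> Domain F)"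

definition tree_at :: "'a set \<Rightarrow> ('a \<times> 'a) set \<Rightarrow> 'a \<Rightarrow> 'a set" where
  "tree_at V F r = {x \<in> V. root_of F x = r}"

text \<open>Arcs are chosen by their tails, while heads may lie on either side of \<open>A\<close>.
  So each vertex keeps at most one outgoing arc if it has at most one in \<open>F\<close> and in
  \<open>G\<close>, and the two opposite mixes together use each arc of \<open>F\<close> and of
  \<open>G\<close> once.\<close>

definition mix :: "'a set \<Rightarrow> ('a \<times> 'a) set \<Rightarrow> ('a \<times> 'a) set \<Rightarrow> ('a \<times> 'a) set" where
  "mix A F G = {(i, j). if i \<in> A then (i, j) \<in> F else (i, j) \<in> G}"

lemma is_forest_iff:
  "is_forest V F \<longleftrightarrow> F \<subseteq> V \<times> V \<and> single_valued F \<and> acyclic F"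
  by (auto simp: is_forest_def single_valued_def)

lemma is_forestD:
  assumes "is_forest V F"
  shows "F \<subseteq> V \<times> V" "single_valued F" "acyclic F"
  using assms by (auto simp: is_forest_iff)

lemma rtrancl_outside_Domain: "(x, y) \<in> F\<^sup>* \<Longrightarrow> x \<notin> Domain F \<Longrightarrow> x = y"
  by (metis Domain.DomainI converse_rtranclE)

lemma rtrancl_closed:
  assumes "(x, y) \<in> R\<^sup>*" "x \<in> S" "\<And>i j. (i, j) \<in> R \<Longrightarrow> i \<in> S \<Longrightarrow> j \<in> S"
  shows "y \<in> S"
  using assms by (induction rule: rtrancl_induct) auto

lemma root_unique:
  assumes "single_valued F" "(x, r) \<in> F\<^sup>*" "r \<notin> Domain F" "(x, s) \<in> F\<^sup>*" "s \<notin> Domain F"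
  shows "r = s"
  using single_valued_confluent[OF assms(1,2,4)] assms(3,5) rtrancl_outside_Domain by metis

lemma root_of_eqI:
  assumes "single_valued F" "(x, r) \<in> F\<^sup>*" "r \<notin> Domain F"
  shows "root_of F x = r"
  unfolding root_of_def
  by (rule the_equality) (use assms root_unique[OF assms(1)] in auto)

text \<open>The converse of a finite acyclic relation is well-founded. The transitive closure is
  needed because a walk may leave \<open>S\<close> and come back.\<close>

lemma acyclic_has_maximal:
  assumes "finite F" "acyclic F" "x \<in> S"
  shows "\<exists>y\<in>S. \<forall>z. (y, z) \<in> F\<^sup>+ \<longrightarrow> z \<notin> S"
proof -
  have "wf ((F\<inverse>)\<^sup>+)"
    using finite_acyclic_wf_converse[OF assms(1,2)] wf_trancl by blast
  then obtain y where "y \<in> S" "\<And>z. (z, y) \<in> (F\<inverse>)\<^sup>+ \<Longrightarrow> z \<notin> S"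
    using assms(3) by (metis wfE_min)
  then show ?thesis
    by (metis converse_iff trancl_converse)
qed

section \<open>Trees of a finite forest, indexed by their roots\<close>

locale finite_forest =
  fixes V :: "'a set" and F :: "('a \<times> 'a) set"
  assumes finite_vertices: "finite V" and forest: "is_forest V F"
begin

lemma arcs_subset: "F \<subseteq> V \<times> V" and functional: "single_valued F" and acyclic: "acyclic F"
  using is_forestD[OF forest] by auto

lemma finite_arcs: "finite F"
  using arcs_subset finite_vertices by (meson finite_SigmaI finite_subset)

lemma reach_in_vertices: "(x, y) \<in> F\<^sup>* \<Longrightarrow> x \<in> V \<Longrightarrow> y \<in> V"
  using rtrancl_closed[of x y F V] arcs_subset by blast

lemma root_exists: "\<exists>r. (x, r) \<in> F\<^sup>* \<and> r \<notin> Domain F"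
proof -
  obtain y where y: "(x, y) \<in> F\<^sup>*" "\<And>z. (y, z) \<in> F\<^sup>+ \<Longrightarrow> (x, z) \<notin> F\<^sup>*"
    using acyclic_has_maximal[OF finite_arcs acyclic, of x "{y. (x, y) \<in> F\<^sup>*}"] by auto
  then have "y \<notin> Domain F"
    by (meson DomainE r_into_trancl' rtrancl.rtrancl_into_rtrancl)
  with y show ?thesis by blast
qed

lemma reach_root_of: "(x, root_of F x) \<in> F\<^sup>*" and root_of_no_arc: "root_of F x \<notin> Domain F"
  using root_exists[of x] root_of_eqI[OF functional, of x] by auto

lemma root_of_in_roots: "x \<in> V \<Longrightarrow> root_of F x \<in> roots V F"
  using reach_in_vertices[OF reach_root_of] root_of_no_arc by (auto simp: roots_def)

lemma root_of_root: "r \<in> roots V F \<Longrightarrow> root_of F r = r"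
  by (rule root_of_eqI[OF functional]) (auto simp: roots_def)

lemma root_of_reach: "(x, y) \<in> F\<^sup>* \<Longrightarrow> root_of F x = root_of F y"
  by (rule root_of_eqI[OF functional]) (use reach_root_of[of y] root_of_no_arc in auto)

lemma root_of_arc: "(x, y) \<in> F \<Longrightarrow> root_of F x = root_of F y"
  by (simp add: r_into_rtrancl root_of_reach)

lemma root_of_symcl: "(x, y) \<in> (F \<union> F\<inverse>)\<^sup>* \<Longrightarrow> root_of F x = root_of F y"
  by (induction rule: rtrancl_induct) (auto dest: root_of_arc)

lemma symcl_iff: "(x, y) \<in> (F \<union> F\<inverse>)\<^sup>* \<longleftrightarrow> root_of F x = root_of F y"
proof
  assume eq: "root_of F x = root_of F y"
  have "(x, root_of F x) \<in> (F \<union> F\<inverse>)\<^sup>*"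
    using reach_root_of[of x] by (metis in_rtrancl_UnI)
  moreover have "(root_of F y, y) \<in> (F \<union> F\<inverse>)\<^sup>*"
    using reach_root_of[of y] by (metis in_rtrancl_UnI rtrancl_converseI)
  ultimately show "(x, y) \<in> (F \<union> F\<inverse>)\<^sup>*"
    using eq by (metis rtrancl_trans)
qed (rule root_of_symcl)

lemma components_eq: "components V F = tree_at V F ` roots V F"
proof -
  let ?R = "{(x, y). x \<in> V \<and> y \<in> V \<and> (x, y) \<in> (F \<union> F\<inverse>)\<^sup>*}"
  have cls: "?R `` {x} = tree_at V F (root_of F x)" if "x \<in> V" for x
    using that by (auto simp: tree_at_def symcl_iff)
  show ?thesis
  proof
    show "components V F \<subseteq> tree_at V F ` roots V F"
      using cls root_of_in_roots by (auto simp: components_def quotient_def)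
    show "tree_at V F ` roots V F \<subseteq> components V F"
    proof
      fix S assume "S \<in> tree_at V F ` roots V F"
      then obtain r where "r \<in> roots V F" "S = tree_at V F r" by blast
      then have "r \<in> V" "S = ?R `` {r}"
        using cls[of r] root_of_root[of r] by (auto simp: roots_def)
      then show "S \<in> components V F"
        unfolding components_def by (auto simp: quotient_def)
    qed
  qed
qed

text \<open>Roots are recognised vertex by vertex, so counting them instead of components makes the
  number of trees additive under exchanges.\<close>

lemma card_components: "card (components V F) = card (roots V F)"
proof -
  have "inj_on (tree_at V F) (roots V F)"
  proof (rule inj_onI)
    fix r s assume rs: "r \<in> roots V F" "s \<in> roots V F" "tree_at V F r = tree_at V F s"
    have "r \<in> tree_at V F r"
      using rs(1) root_of_root[of r] by (auto simp: tree_at_def roots_def)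
    then have "r \<in> tree_at V F s"
      using rs(3) by simp
    then show "r = s"
      using rs(1) root_of_root[of r] by (simp add: tree_at_def)
  qed
  then show ?thesis
    by (simp add: components_eq card_image)
qed

lemma tree_at_closed: "(i, j) \<in> F \<Longrightarrow> i \<in> tree_at V F r \<longleftrightarrow> j \<in> tree_at V F r"
  using arcs_subset root_of_arc by (auto simp: tree_at_def)

lemma roots_tree_at: "r \<in> roots V F \<Longrightarrow> roots V F \<inter> tree_at V F r = {r}"
  using root_of_root by (auto simp: tree_at_def roots_def)

end

text \<open>An induced subgraph of a forest is a forest, and its roots are the vertices of
  \<open>E\<close> whose arc, if any, leaves \<open>E\<close>.\<close>

lemma is_tree_induced_iff:
  assumes "finite V" "is_forest V F" "E \<subseteq> V"
  shows "is_tree E {(i, j). (i, j) \<in> F \<and> i \<in> E \<and> j \<in> E} \<longleftrightarrow> card {i \<in> E. \<forall>j\<in>E. (i, j) \<notin> F} = 1"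
proof -
  let ?F = "{(i, j). (i, j) \<in> F \<and> i \<in> E \<and> j \<in> E}"
  have "acyclic ?F"
    by (rule acyclic_subset[OF is_forestD(3)[OF assms(2)]]) auto
  then have f: "is_forest E ?F"
    using assms(2) by (auto simp: is_forest_iff single_valued_def)
  have "finite E" using assms finite_subset by blast
  then interpret finite_forest E ?F using f by unfold_locales
  have "roots E ?F = {i \<in> E. \<forall>j\<in>E. (i, j) \<notin> F}"
    by (auto simp: roots_def)
  then show ?thesis
    using f by (simp add: is_tree_def card_components)
qed

section \<open>Acyclicity by cutting the vertex set in two\<close>

lemma trancl_split:
  assumes "(x, y) \<in> R\<^sup>+" "\<And>i j. (i, j) \<in> R \<Longrightarrow> i \<notin> B \<Longrightarrow> j \<notin> B"
  shows "x \<in> B \<and> y \<in> B \<and> (x, y) \<in> (R \<inter> B \<times> B)\<^sup>+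
       \<or> x \<in> B \<and> y \<notin> B \<or> x \<notin> B \<and> y \<notin> B \<and> (x, y) \<in> (R \<inter> (- B) \<times> (- B))\<^sup>+"
  using assms(1)
proof (induction rule: trancl_induct)
  case (base y)
  then show ?case using assms(2)[of x y] by auto
next
  case (step y z)
  then show ?case
    using assms(2)[of y z]
    by (cases "y \<in> B"; cases "z \<in> B") (auto intro: trancl_into_trancl)
qed

text \<open>A closed walk that leaves \<open>B\<close> cannot return, so it lies entirely in
  \<open>B\<close> or entirely in the complement.\<close>

lemma acyclic_split:
  assumes "\<And>i j. (i, j) \<in> R \<Longrightarrow> i \<notin> B \<Longrightarrow> j \<notin> B"
    and "acyclic (R \<inter> B \<times> B)" "acyclic (R \<inter> (- B) \<times> (- B))"
  shows "acyclic R"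
proof (rule acyclicI, intro allI notI)
  fix x assume "(x, x) \<in> R\<^sup>+"
  from trancl_split[OF this assms(1)]
  have "(x, x) \<in> (R \<inter> B \<times> B)\<^sup>+ \<or> (x, x) \<in> (R \<inter> (- B) \<times> (- B))\<^sup>+" by auto
  then show False using assms(2,3) by (simp add: acyclic_def)
qed

lemma acyclic_split':
  assumes "\<And>i j. (i, j) \<in> R \<Longrightarrow> i \<in> B \<Longrightarrow> j \<in> B"
    and "acyclic (R \<inter> B \<times> B)" "acyclic (R \<inter> (- B) \<times> (- B))"
  shows "acyclic R"
  by (rule acyclic_split[of _ "- B"]) (use assms in auto)

section \<open>Roots, weight and acyclicity of exchanged digraphs\<close>

lemma single_valued_mix: "single_valued F \<Longrightarrow> single_valued G \<Longrightarrow> single_valued (mix A F G)"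
  by (auto simp: single_valued_def mix_def)

lemma mix_subset: "F \<subseteq> S \<Longrightarrow> G \<subseteq> S \<Longrightarrow> mix A F G \<subseteq> S"
  by (auto simp: mix_def split: if_splits)

lemma roots_mix: "roots V (mix A F G) = (roots V F \<inter> A) \<union> (roots V G - A)"
  by (auto simp: roots_def mix_def split: if_splits)

lemma card_roots_mix:
  assumes "finite V"
  shows "card (roots V (mix A F G)) = card (roots V F \<inter> A) + card (roots V G - A)"
  unfolding roots_mix using assms by (subst card_Un_disjoint) (auto simp: roots_def)

lemma card_roots_split:
  assumes "finite V"
  shows "card (roots V F \<inter> A) + card (roots V F - A) = card (roots V F)"
  using card_Int_Diff[of "roots V F" A] assms by (simp add: roots_def)

lemma weight_mix:
  assumes "finite F" "finite G"
  shows "weight v (mix A F G) + weight v (mix A G F) = weight v F + weight v G"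
proof -
  have *: "weight v (mix A F G) = weight v (F \<inter> A \<times> UNIV) + weight v (G \<inter> (- A) \<times> UNIV)"
    if "finite F" "finite G" for F G
  proof -
    have "mix A F G = (F \<inter> A \<times> UNIV) \<union> (G \<inter> (- A) \<times> UNIV)"
      by (auto simp: mix_def split: if_splits)
    then show ?thesis
      unfolding weight_def using that by (simp, subst sum.union_disjoint) auto
  qed
  have **: "weight v F = weight v (F \<inter> A \<times> UNIV) + weight v (F \<inter> (- A) \<times> UNIV)"
    if "finite F" for F
    using *[OF that that] by (simp add: mix_def)
  show ?thesis
    using *[OF assms] *[OF assms(2,1)] **[OF assms(1)] **[OF assms(2)] by simp
qed

lemma is_forest_mix:
  assumes "is_forest V F" "is_forest V G" "acyclic (mix A F G)"
  shows "is_forest V (mix A F G)"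
  using assms by (simp add: is_forest_iff single_valued_mix mix_subset)

text \<open>Arcs of \<open>F\<close> may leave \<open>A\<close>, but the arcs of \<open>G\<close>
  starting outside never lead back, so a cycle would belong to \<open>F\<close> or to
  \<open>G\<close> alone.\<close>

lemma acyclic_mix_no_entry:
  assumes "acyclic F" "acyclic G" "\<And>i j. (i, j) \<in> G \<Longrightarrow> i \<notin> A \<Longrightarrow> j \<notin> A"
  shows "acyclic (mix A F G)"
proof (rule acyclic_split[of _ A])
  show "\<And>i j. (i, j) \<in> mix A F G \<Longrightarrow> i \<notin> A \<Longrightarrow> j \<notin> A"
    using assms(3) by (auto simp: mix_def)
qed (auto simp: mix_def intro: acyclic_subset[OF assms(1)] acyclic_subset[OF assms(2)])

lemma acyclic_mix_no_exit:
  assumes "acyclic F" "acyclic G" "\<And>i j. (i, j) \<in> F \<Longrightarrow> i \<in> A \<Longrightarrow> j \<in> A"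
  shows "acyclic (mix A F G)"
proof (rule acyclic_split'[of _ A])
  show "\<And>i j. (i, j) \<in> mix A F G \<Longrightarrow> i \<in> A \<Longrightarrow> j \<in> A"
    using assms(3) by (auto simp: mix_def)
qed (auto simp: mix_def intro: acyclic_subset[OF assms(1)] acyclic_subset[OF assms(2)])

text \<open>Every cycle of this exchange must leave the subtree of x, and the only way out is the arc (x, z).\<close>

lemma acyclic_mix_subtree:
  assumes "single_valued F" "acyclic F" "acyclic G" "(x, z) \<in> F"
  shows "acyclic (mix {u. (u, x) \<in> F\<^sup>*} F G - {(x, z)})"
proof (rule acyclic_split'[of _ "{u. (u, x) \<in> F\<^sup>*}"])
  fix i j assume "(i, j) \<in> mix {u. (u, x) \<in> F\<^sup>*} F G - {(x, z)}" "i \<in> {u. (u, x) \<in> F\<^sup>*}"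
  then have ij: "(i, j) \<in> F" "(i, x) \<in> F\<^sup>*" "i \<noteq> x"
    using assms(1,4) by (auto simp: mix_def single_valued_def)
  then obtain k where "(i, k) \<in> F" "(k, x) \<in> F\<^sup>*"
    by (metis converse_rtranclE)
  then show "j \<in> {u. (u, x) \<in> F\<^sup>*}"
    using ij assms(1) by (auto simp: single_valued_def)
qed (auto simp: mix_def intro: acyclic_subset[OF assms(2)] acyclic_subset[OF assms(3)])

text \<open>If all arcs on closed walks were in \<open>S\<close>, every closed walk would survive in
  \<open>R \<inter> S\<close>.\<close>

lemma cyclic_arc_outside:
  assumes "\<not> acyclic R" "acyclic (R \<inter> S)"
  obtains a b where "(a, b) \<in> R" "(a, b) \<notin> S" "(b, a) \<in> R\<^sup>*"
proof (rule ccontr)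
  assume "\<not> thesis"
  with that have S: "(a, b) \<in> S" if "(a, b) \<in> R" "(b, a) \<in> R\<^sup>*" for a b
    using that by blast
  \<comment> \<open>Stated for walks that can be continued back to their start, so that the
    induction hypothesis covers initial segments.\<close>
  have "(x, y) \<in> (R \<inter> S)\<^sup>+" if "(x, y) \<in> R\<^sup>+" "(y, x) \<in> R\<^sup>*" for x y
    using that
  proof (induction rule: trancl_induct)
    case (base y)
    then show ?case using S by blast
  next
    case (step y z)
    have "(y, x) \<in> R\<^sup>*" using step.hyps(2) step.prems by (rule converse_rtrancl_into_rtrancl)
    moreover have "(z, y) \<in> R\<^sup>*"
      using step.prems trancl_into_rtrancl[OF step.hyps(1)] by (rule rtrancl_trans)
    ultimately show ?case
      using step.IH S[OF step.hyps(2)] step.hyps(2) by (meson IntI trancl_into_trancl)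
  qed
  then show False using assms unfolding acyclic_def by (meson trancl_into_rtrancl)
qed

text \<open>The walk of \<open>F\<close> from \<open>x\<close> stays in \<open>S\<close>, so it is
  also a walk of \<open>G\<close>, and its end has no arc in either. Elsewhere \<open>G\<close> may
  have cycles.\<close>

lemma root_of_agree:
  assumes F: "finite_forest V F" and G: "single_valued G" and x: "x \<in> S"
    and closed: "\<And>i j. (i, j) \<in> F \<Longrightarrow> i \<in> S \<Longrightarrow> j \<in> S"
    and agree: "\<And>i j. i \<in> S \<Longrightarrow> (i, j) \<in> F \<longleftrightarrow> (i, j) \<in> G"
  shows "root_of G x = root_of F x"
proof -
  interpret F: finite_forest V F by fact
  have "(x, y) \<in> G\<^sup>* \<and> y \<in> S" if "(x, y) \<in> F\<^sup>*" for y
    using that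
  proof (induction rule: rtrancl_induct)
    case (step y z)
    then have "(y, z) \<in> G" "z \<in> S" using agree closed by auto
    with step show ?case by (meson rtrancl.rtrancl_into_rtrancl)
  qed (use x in auto)
  from this[OF F.reach_root_of] have "(x, root_of F x) \<in> G\<^sup>*" "root_of F x \<in> S" by auto
  moreover have "root_of F x \<notin> Domain G"
    using F.root_of_no_arc[of x] agree[OF \<open>root_of F x \<in> S\<close>] by auto
  ultimately show ?thesis by (intro root_of_eqI[OF G])
qed

section \<open>Atoms of a generated algebra\<close>

lemma gen_algebra_subset:
  assumes "\<And>S. S \<in> G \<Longrightarrow> S \<subseteq> \<Omega>" "A \<in> gen_algebra \<Omega> G"
  shows "A \<subseteq> \<Omega>"
  using assms(2) by induction (use assms(1) in auto)

lemma gen_algebra_Int: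
  assumes "\<And>S. S \<in> G \<Longrightarrow> S \<subseteq> \<Omega>" "A \<in> gen_algebra \<Omega> G" "B \<in> gen_algebra \<Omega> G"
  shows "A \<inter> B \<in> gen_algebra \<Omega> G"
proof -
  have "A \<inter> B = \<Omega> - ((\<Omega> - A) \<union> (\<Omega> - B))"
    using gen_algebra_subset[OF assms(1,2)] by auto
  then show ?thesis
    using assms(2,3) by (simp add: gen_algebra.compl gen_algebra.union)
qed

lemma gen_algebra_separates:
  assumes "A \<in> gen_algebra \<Omega> G" "x \<in> \<Omega>" "y \<in> \<Omega>" "\<And>S. S \<in> G \<Longrightarrow> x \<in> S \<longleftrightarrow> y \<in> S"
  shows "x \<in> A \<longleftrightarrow> y \<in> A"
  using assms(1) by induction (use assms(2-) in auto)

lemma gen_algebra_INT: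
  assumes "\<And>S. S \<in> G \<Longrightarrow> S \<subseteq> \<Omega>" "finite I" "\<And>i. i \<in> I \<Longrightarrow> B i \<in> gen_algebra \<Omega> G"
  shows "\<Omega> \<inter> (\<Inter>i\<in>I. B i) \<in> gen_algebra \<Omega> G"
  using assms(2,3)
proof (induction rule: finite_induct)
  case empty
  show ?case using gen_algebra.compl[OF gen_algebra.empty, of \<Omega> G] by simp
next
  case (insert i I)
  have "\<Omega> \<inter> (\<Inter>j\<in>insert i I. B j) = B i \<inter> (\<Omega> \<inter> (\<Inter>j\<in>I. B j))" by auto
  then show ?case using insert gen_algebra_Int[OF assms(1)] by simp
qed

text \<open>Points that no generator separates are separated by no set of the algebra. Conversely,
  each point outside a class is cut off by a generator or its complement, and by finiteness the
  class is a finite intersection of such sets.\<close>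

lemma atom_gen_algebra_iff:
  assumes fin: "finite \<Omega>" and sub: "\<And>S. S \<in> G \<Longrightarrow> S \<subseteq> \<Omega>"
  shows "is_atom (gen_algebra \<Omega> G) E \<longleftrightarrow>
    (\<exists>x\<in>\<Omega>. E = {y \<in> \<Omega>. \<forall>S\<in>G. x \<in> S \<longleftrightarrow> y \<in> S})"
proof
  assume E: "is_atom (gen_algebra \<Omega> G) E"
  then obtain x where x: "x \<in> E" and alg: "E \<in> gen_algebra \<Omega> G" by (auto simp: is_atom_def)
  have x\<Omega>: "x \<in> \<Omega>" using gen_algebra_subset[OF sub alg] x by blast
  have le: "y \<in> S" if "y \<in> E" "S \<in> gen_algebra \<Omega> G" "x \<in> S" for y S
  proof -
    have "E \<inter> S \<in> gen_algebra \<Omega> G" using gen_algebra_Int[OF sub alg that(2)] .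
    then have "E \<inter> S = {} \<or> E \<inter> S = E" using E by (auto simp: is_atom_def)
    with that x show ?thesis by blast
  qed
  have "x \<in> S \<longleftrightarrow> y \<in> S" if "y \<in> E" "S \<in> G" for y S
  proof
    assume "y \<in> S"
    then have "y \<notin> \<Omega> - S" by blast
    then have "x \<notin> \<Omega> - S" using le[OF that(1)] that(2) by (meson gen_algebra.basic gen_algebra.compl)
    then show "x \<in> S" using x\<Omega> by blast
  qed (use le that gen_algebra.basic in metis)
  moreover have "y \<in> E" if "y \<in> \<Omega>" "\<forall>S\<in>G. x \<in> S \<longleftrightarrow> y \<in> S" for y
    using gen_algebra_separates[OF alg x\<Omega> that(1)] that(2) x by blast
  ultimately have "E = {y \<in> \<Omega>. \<forall>S\<in>G. x \<in> S \<longleftrightarrow> y \<in> S}"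
    using gen_algebra_subset[OF sub alg] by blast
  then show "\<exists>x\<in>\<Omega>. E = {y \<in> \<Omega>. \<forall>S\<in>G. x \<in> S \<longleftrightarrow> y \<in> S}" using x\<Omega> by blast
next
  assume "\<exists>x\<in>\<Omega>. E = {y \<in> \<Omega>. \<forall>S\<in>G. x \<in> S \<longleftrightarrow> y \<in> S}"
  then obtain x where x: "x \<in> \<Omega>" and E: "E = {y \<in> \<Omega>. \<forall>S\<in>G. x \<in> S \<longleftrightarrow> y \<in> S}" by blast
  have "\<exists>B. B \<in> gen_algebra \<Omega> G \<and> E \<subseteq> B \<and> y \<notin> B" if y: "y \<in> \<Omega> - E" for y
  proof -
    obtain S where S: "S \<in> G" "(x \<in> S) \<noteq> (y \<in> S)" using y E by blast
    show ?thesis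
    proof (cases "x \<in> S")
      case True
      then show ?thesis using S E by (intro exI[of _ S]) (auto intro: gen_algebra.basic)
    next
      case False
      then show ?thesis
        using S E y by (intro exI[of _ "\<Omega> - S"]) (auto intro: gen_algebra.basic gen_algebra.compl)
    qed
  qed
  then obtain B where B: "\<And>y. y \<in> \<Omega> - E \<Longrightarrow> B y \<in> gen_algebra \<Omega> G \<and> E \<subseteq> B y \<and> y \<notin> B y"
    by metis
  have "\<Omega> \<inter> (\<Inter>y\<in>\<Omega> - E. B y) \<in> gen_algebra \<Omega> G"
    by (rule gen_algebra_INT[OF sub]) (use fin B in auto)
  moreover have "\<Omega> \<inter> (\<Inter>y\<in>\<Omega> - E. B y) = E"
  proof
    show "\<Omega> \<inter> (\<Inter>y\<in>\<Omega> - E. B y) \<subseteq> E" using B by blast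
    show "E \<subseteq> \<Omega> \<inter> (\<Inter>y\<in>\<Omega> - E. B y)" using B E by blast
  qed
  ultimately have alg: "E \<in> gen_algebra \<Omega> G" by simp
  have "D = {} \<or> D = E" if D: "D \<in> gen_algebra \<Omega> G" "D \<subseteq> E" for D
  proof -
    have "y \<in> D \<longleftrightarrow> z \<in> D" if "y \<in> E" "z \<in> E" for y z
      by (rule gen_algebra_separates[OF D(1)]) (use that E in auto)
    then show ?thesis using D(2) by blast
  qed
  moreover have "x \<in> E" using x E by blast
  ultimately show "is_atom (gen_algebra \<Omega> G) E" using alg by (auto simp: is_atom_def)
qed

section \<open>Minimal forests\<close>

locale weighted_digraph =
  fixes Vs :: "'a set" and Arcs :: "('a \<times> 'a) set" and v :: "'a \<Rightarrow> 'a \<Rightarrow> real"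
  assumes finite_Vs: "finite Vs" and Arcs_subset: "Arcs \<subseteq> Vs \<times> Vs"
    and spanning_tree: "spanning_forests Vs Arcs 1 \<noteq> {}"
begin

abbreviation SF :: "nat \<Rightarrow> ('a \<times> 'a) set set" where
  "SF \<equiv> spanning_forests Vs Arcs"

abbreviation MF :: "nat \<Rightarrow> ('a \<times> 'a) set set" where
  "MF \<equiv> min_forests Vs Arcs v"

text \<open>The real value of \<open>phi\<close> at positive levels; it keeps infinity, which occurs
  only at level 0, out of the calculations.\<close>

definition min_weight :: "nat \<Rightarrow> real" where
  "min_weight k = Min (weight v ` SF k)"

text \<open>On \<open>Vs\<close>, the classes of this relation turn out to be the atoms of
  \<open>alg Vs Arcs v k\<close>.\<close>

definition same_tree :: "nat \<Rightarrow> ('a \<times> 'a) set" where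
  "same_tree k = {(x, y). x \<in> Vs \<and> y \<in> Vs \<and> (\<forall>F\<in>MF k. root_of F x = root_of F y)}"

lemma not_same_treeI: "F \<in> MF k \<Longrightarrow> root_of F x \<noteq> root_of F y \<Longrightarrow> (x, y) \<notin> same_tree k"
  by (auto simp: same_tree_def)

lemma finite_forestI: "is_forest Vs F \<Longrightarrow> finite_forest Vs F"
  using finite_Vs by unfold_locales

lemma SF_iff: "F \<in> SF k \<longleftrightarrow> F \<subseteq> Arcs \<and> is_forest Vs F \<and> card (roots Vs F) = k"
  using finite_forest.card_components[OF finite_forestI] by (auto simp: spanning_forests_def)

lemma SF_D:
  assumes "F \<in> SF k"
  shows "F \<subseteq> Arcs" "is_forest Vs F" "card (roots Vs F) = k" "finite_forest Vs F" "finite F"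
  using assms finite_forestI finite_forest.finite_arcs by (auto simp: SF_iff)

lemma finite_roots: "finite (roots Vs F)"
  using finite_Vs by (simp add: roots_def)

lemma finite_Arcs: "finite Arcs"
  using finite_Vs Arcs_subset by (meson finite_SigmaI finite_subset)

lemma finite_SF: "finite (SF k)"
  by (rule finite_subset[of _ "Pow Arcs"]) (auto simp: SF_iff finite_Arcs)

lemma Vs_nonempty: "Vs \<noteq> {}"
proof -
  obtain F where "card (roots Vs F) = 1" using spanning_tree SF_iff by blast
  then show ?thesis by (auto simp: roots_def)
qed

lemma SF_level: "F \<in> SF k \<Longrightarrow> 1 \<le> k \<and> k \<le> card Vs"
proof -
  assume F: "F \<in> SF k"
  obtain x where "x \<in> Vs" using Vs_nonempty by blast
  then have "roots Vs F \<noteq> {}"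
    using finite_forest.root_of_in_roots[OF SF_D(4)[OF F]] by blast
  then have "1 \<le> card (roots Vs F)"
    by (simp add: Suc_leI card_gt_0_iff finite_roots)
  then show ?thesis
    using SF_D(3)[OF F] card_mono[OF finite_Vs, of "roots Vs F"] by (auto simp: roots_def)
qed

text \<open>Deleting an arc from a forest leaves a forest with exactly one more root.\<close>

lemma SF_nonempty:
  assumes "1 \<le> k" "k \<le> card Vs"
  shows "SF k \<noteq> {}"
  using assms
proof (induction k rule: dec_induct)
  case base
  then show ?case using spanning_tree by simp
next
  case (step k)
  then obtain F where F: "F \<in> SF k" by auto
  have "roots Vs F \<noteq> Vs" using SF_D(3)[OF F] step by auto
  then obtain i j where ij: "(i, j) \<in> F" "i \<in> Vs" by (auto simp: roots_def)
  have sv: "single_valued F" using SF_D(2)[OF F] by (rule is_forestD)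
  then have "roots Vs (F - {(i, j)}) = insert i (roots Vs F)"
    using ij by (auto simp: roots_def single_valued_def)
  moreover have "i \<notin> roots Vs F" using ij by (auto simp: roots_def)
  ultimately have "card (roots Vs (F - {(i, j)})) = Suc k"
    using SF_D(3)[OF F] finite_roots by simp
  moreover have "is_forest Vs (F - {(i, j)})"
    using SF_D(2)[OF F] by (auto simp: is_forest_iff single_valued_def intro: acyclic_subset)
  ultimately have "F - {(i, j)} \<in> SF (Suc k)"
    using SF_D(1)[OF F] by (auto simp: SF_iff)
  then show ?case by blast
qed

lemma min_weight_le: "F \<in> SF k \<Longrightarrow> min_weight k \<le> weight v F"
  unfolding min_weight_def using finite_SF by simp

lemma MF_iff: "F \<in> MF k \<longleftrightarrow> F \<in> SF k \<and> weight v F = min_weight k"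
  using SF_level[of F k] by (auto simp: min_forests_def phi_def min_weight_def)

lemma MF_SF: "F \<in> MF k \<Longrightarrow> F \<in> SF k"
  by (simp add: MF_iff)

lemma MF_nonempty:
  assumes "1 \<le> k" "k \<le> card Vs"
  obtains F where "F \<in> MF k"
proof -
  have "min_weight k \<in> weight v ` SF k"
    unfolding min_weight_def using finite_SF SF_nonempty[OF assms] by (intro Min_in) auto
  then show ?thesis using that MF_iff by fastforce
qed

section \<open>Exchanges between minimal forests\<close>

lemma mix_SF:
  assumes "F \<in> SF a" "G \<in> SF b" "acyclic (mix A F G)"
    "card (roots Vs F \<inter> A) + card (roots Vs G - A) = c"
  shows "mix A F G \<in> SF c"
  using assms SF_D(1,2)[OF assms(1)] SF_D(1,2)[OF assms(2)] is_forest_mix mix_subset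
  by (metis SF_iff card_roots_mix finite_Vs)

text \<open>The results have the total weight of \<open>F\<close> and \<open>G\<close>, and each
  weighs at least the minimum at its level; \<open>le\<close> leaves no slack.\<close>

lemma exchange:
  assumes F: "F \<in> MF a" and G: "G \<in> MF b"
    and FG: "mix A F G \<in> SF c" and GF: "mix A G F \<in> SF d"
    and le: "min_weight a + min_weight b \<le> min_weight c + min_weight d"
  shows "mix A F G \<in> MF c" "mix A G F \<in> MF d"
proof -
  have "weight v (mix A F G) + weight v (mix A G F) = min_weight a + min_weight b"
    using weight_mix[of F G] F G SF_D(5) by (auto simp: MF_iff)
  then show "mix A F G \<in> MF c" "mix A G F \<in> MF d"
    using min_weight_le[OF FG] min_weight_le[OF GF] le FG GF by (auto simp: MF_iff)
qed

text \<open>No arc of \<open>G\<close> crosses the border of the tree, so either mix crosses it in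
  one direction at most. The root \<open>r\<close> passes from one forest to the other.\<close>

lemma mix_tree_SF:
  assumes F: "F \<in> SF a" and G: "G \<in> SF (Suc b)" and r: "r \<in> roots Vs G"
    and free: "roots Vs F \<inter> tree_at Vs G r = {}"
  shows "mix (tree_at Vs G r) G F \<in> SF (Suc a)" "mix (tree_at Vs G r) F G \<in> SF b"
proof -
  let ?C = "tree_at Vs G r"
  interpret G: finite_forest Vs G using SF_D(4)[OF G] .
  have rG: "card (roots Vs G \<inter> ?C) = 1" using G.roots_tree_at[OF r] by simp
  have F0: "roots Vs F - ?C = roots Vs F" using free by blast
  have "acyclic (mix ?C G F)"
    by (rule acyclic_mix_no_exit[OF G.acyclic is_forestD(3)[OF SF_D(2)[OF F]]])
      (use G.tree_at_closed in blast)
  then show "mix ?C G F \<in> SF (Suc a)"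
    by (rule mix_SF[OF G F]) (simp add: rG F0 SF_D(3)[OF F])
  have "acyclic (mix ?C F G)"
    by (rule acyclic_mix_no_entry[OF is_forestD(3)[OF SF_D(2)[OF F]] G.acyclic])
      (use G.tree_at_closed in blast)
  then show "mix ?C F G \<in> SF b"
    using card_roots_split[OF finite_Vs, of G ?C]
    by (intro mix_SF[OF F G]) (simp_all add: rG free SF_D(3)[OF G])
qed

text \<open>Pigeonhole: the \<open>a\<close> roots of \<open>F\<close> meet at most \<open>a\<close>
  of the \<open>b\<close> trees of \<open>G\<close>.\<close>

lemma free_tree_exists:
  assumes F: "F \<in> SF a" and G: "G \<in> SF b" and "a < b"
  obtains r where "r \<in> roots Vs G" "roots Vs F \<inter> tree_at Vs G r = {}"
proof -
  have "card (root_of G ` roots Vs F) \<le> a"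
    using card_image_le[OF finite_roots, of "root_of G" F] SF_D(3)[OF F] by simp
  then have "\<not> roots Vs G \<subseteq> root_of G ` roots Vs F"
    using card_mono[OF finite_imageI[OF finite_roots]] SF_D(3)[OF G] assms(3)
    by (metis le_trans not_le)
  then show ?thesis using that by (auto simp: tree_at_def)
qed

lemma exchange_free_tree:
  assumes F: "F \<in> MF k" and G: "G \<in> MF (Suc k)" and r: "r \<in> roots Vs G"
    and free: "roots Vs F \<inter> tree_at Vs G r = {}"
  shows "mix (tree_at Vs G r) G F \<in> MF (Suc k)"
proof -
  note m = mix_tree_SF[OF MF_SF[OF F] MF_SF[OF G] r free]
  show ?thesis by (rule exchange(2)[OF F G m(2,1)]) simp
qed

section \<open>Convexity of the minimal weights and a Lagrangian cost\<close>

lemma min_weight_convex: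
  assumes "1 \<le> j" "j + 2 \<le> card Vs"
  shows "2 * min_weight (Suc j) \<le> min_weight j + min_weight (Suc (Suc j))"
proof -
  obtain F where F: "F \<in> MF j" using MF_nonempty assms by (metis add_leD1)
  obtain G where G: "G \<in> MF (Suc (Suc j))" using MF_nonempty assms by (metis add_2_eq_Suc' le_Suc_eq)
  obtain r where r: "r \<in> roots Vs G" "roots Vs F \<inter> tree_at Vs G r = {}"
    using free_tree_exists[OF MF_SF[OF F] MF_SF[OF G]] by auto
  note m = mix_tree_SF[OF MF_SF[OF F] MF_SF[OF G] r]
  have "weight v (mix (tree_at Vs G r) G F) + weight v (mix (tree_at Vs G r) F G)
      = min_weight j + min_weight (Suc (Suc j))"
    using weight_mix[of G F] SF_D(5) F G by (auto simp: MF_iff)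
  then show ?thesis using m[THEN min_weight_le] by simp
qed

lemma slope_antimono:
  assumes "1 \<le> i" "i \<le> j" "j < card Vs"
  shows "min_weight j - min_weight (Suc j) \<le> min_weight i - min_weight (Suc i)"
  using assms(2,1,3)
proof (induction j rule: dec_induct)
  case (step n)
  then show ?case using min_weight_convex[of n] by auto
qed simp

text \<open>A convex sequence lies above the line through its values at \<open>k\<close> and
  \<open>Suc k\<close>: the decrements are at least \<open>l\<close> before \<open>k\<close> and at
  most \<open>l\<close> after it.\<close>

lemma supporting_line:
  assumes k: "1 \<le> k" "k < card Vs" and j: "1 \<le> j" "j \<le> card Vs"
  defines "l \<equiv> min_weight k - min_weight (Suc k)"
  shows "min_weight k + l * real k \<le> min_weight j + l * real j"
proof (cases "j \<le> k")
  case True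
  then show ?thesis using j(1)
  proof (induction j rule: inc_induct)
    case (step n)
    then have "l \<le> min_weight n - min_weight (Suc n)"
      using slope_antimono[of n k] k unfolding l_def by auto
    then show ?case using step by (auto simp: algebra_simps)
  qed simp
next
  case False
  then have "k \<le> j" by simp
  then show ?thesis using j(2)
  proof (induction j rule: dec_induct)
    case (step n)
    then have "min_weight n - min_weight (Suc n) \<le> l"
      using slope_antimono[of k n] k unfolding l_def by auto
    then show ?case using step by (auto simp: algebra_simps)
  qed simp
qed

text \<open>A Lagrangian that charges \<open>l\<close> per root, so that different levels can be
  compared. It also makes sense for digraphs with cycles, where roots no longer count
  components.\<close>

definition cost :: "real \<Rightarrow> ('a \<times> 'a) set \<Rightarrow> real" where
  "cost l F = weight v F + l * real (card (roots Vs F))"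

lemma cost_mix:
  assumes "finite F" "finite G"
  shows "cost l (mix A F G) + cost l (mix A G F) = cost l F + cost l G"
proof -
  have "card (roots Vs (mix A F G)) + card (roots Vs (mix A G F))
      = card (roots Vs F) + card (roots Vs G)"
    using card_roots_split[OF finite_Vs, of F A] card_roots_split[OF finite_Vs, of G A]
    by (simp add: card_roots_mix[OF finite_Vs])
  then have "real (card (roots Vs (mix A F G))) + real (card (roots Vs (mix A G F)))
      = real (card (roots Vs F)) + real (card (roots Vs G))"
    by (metis of_nat_add)
  then show ?thesis
    using weight_mix[OF assms, of v A] unfolding cost_def
    by (simp add: algebra_simps flip: distrib_left)
qed

lemma cost_MF: "F \<in> MF k \<Longrightarrow> cost l F = min_weight k + l * real k"
  by (simp add: cost_def MF_iff SF_iff)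

section \<open>Optimal functional digraphs\<close>

definition slope :: "nat \<Rightarrow> real" where
  "slope k = min_weight k - min_weight (Suc k)"

text \<open>Cycles are allowed. The prescribed value is the common cost of the minimal forests at
  levels \<open>k\<close> and \<open>Suc k\<close>.\<close>

definition optimal :: "nat \<Rightarrow> ('a \<times> 'a) set \<Rightarrow> bool" where
  "optimal k F \<longleftrightarrow> F \<subseteq> Arcs \<and> single_valued F \<and>
     cost (slope k) F = min_weight k + slope k * real k"

lemma optimal_MF: "F \<in> MF k \<Longrightarrow> optimal k F" "F \<in> MF (Suc k) \<Longrightarrow> optimal k F"
  using SF_D(1)[OF MF_SF] is_forestD(2)[OF SF_D(2)[OF MF_SF]]
  by (auto simp: optimal_def cost_MF slope_def algebra_simps)

lemma MF_if_optimal: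
  assumes "F \<in> SF j" "j = k \<or> j = Suc k" "optimal k F"
  shows "F \<in> MF j"
proof -
  have "min_weight k + slope k * real k = min_weight j + slope k * real j"
    using assms(2) by (auto simp: slope_def algebra_simps)
  then show ?thesis
    using assms(1,3) SF_D(3)[OF assms(1)] by (simp add: MF_iff optimal_def cost_def)
qed

text \<open>Induction on the number of vertices lying on cycles, starting from
  \<open>supporting_line\<close>. Otherwise an arc \<open>(a, b)\<close> of some cycle joins two
  atoms, and a minimal forest \<open>W\<close> separates its ends. Both exchanges of
  \<open>F\<close> and \<open>W\<close> on the \<open>W\<close>-tree of \<open>a\<close> have fewer
  such vertices. Costs add up and \<open>W\<close> attains the bound, so the bound passes to
  \<open>F\<close>.\<close>

lemma cost_ge:
  assumes k: "1 \<le> k" "k < card Vs"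
    and "F \<subseteq> Arcs" "single_valued F" "acyclic (F \<inter> same_tree (Suc k))"
  shows "min_weight k + slope k * real k \<le> cost (slope k) F"
  using assms(3-)
proof (induction "card {x. (x, x) \<in> F\<^sup>+}" arbitrary: F rule: less_induct)
  case less
  note F = less.prems
  let ?S = "same_tree (Suc k)"
  show ?case
  proof (cases "acyclic F")
    case True
    then have "F \<in> SF (card (roots Vs F))"
      using F Arcs_subset by (auto simp: SF_iff is_forest_iff)
    then show ?thesis
      using supporting_line[OF k, of "card (roots Vs F)"] SF_level min_weight_le
      by (fastforce simp: cost_def slope_def)
  next
    case False
    then obtain a b where ab: "(a, b) \<in> F" "(a, b) \<notin> ?S" "(b, a) \<in> F\<^sup>*"
      using cyclic_arc_outside F(3) by metis
    have abV: "a \<in> Vs" "b \<in> Vs" using ab(1) F(1) Arcs_subset by auto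
    then obtain W where W: "W \<in> MF (Suc k)" "root_of W a \<noteq> root_of W b"
      using ab(2) by (auto simp: same_tree_def)
    interpret W: finite_forest Vs W using SF_D(4)[OF MF_SF[OF W(1)]] .
    define B where "B = tree_at Vs W (root_of W a)"
    have aB: "a \<in> B" and bB: "b \<notin> B" using abV W(2) by (auto simp: B_def tree_at_def)
    have clB: "i \<in> B \<longleftrightarrow> j \<in> B" if "(i, j) \<in> W" for i j
      using W.tree_at_closed[OF that] by (simp add: B_def)
    have acW: "(x, x) \<notin> R\<^sup>+" if "R \<subseteq> W" for x R
      using acyclic_subset[OF W.acyclic that] by (simp add: acyclic_def)
    define X where "X = mix B F W"
    define Y where "Y = mix B W F"
    have Xno: "\<And>i j. (i, j) \<in> X \<Longrightarrow> i \<notin> B \<Longrightarrow> j \<notin> B"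
      and Yno: "\<And>i j. (i, j) \<in> Y \<Longrightarrow> i \<notin> - B \<Longrightarrow> j \<notin> - B"
      using clB by (auto simp: X_def Y_def mix_def)
    have XY: "X \<inter> B \<times> B \<subseteq> F" "X \<inter> (- B) \<times> (- B) \<subseteq> W" "Y \<inter> B \<times> B \<subseteq> W" "Y \<inter> (- B) \<times> (- B) \<subseteq> F"
      by (auto simp: X_def Y_def mix_def)
    have fin: "finite {x. (x, x) \<in> F\<^sup>+}"
    proof (rule finite_subset[OF _ finite_Vs])
      show "{x. (x, x) \<in> F\<^sup>+} \<subseteq> Vs" using F(1) Arcs_subset by (auto dest!: tranclD)
    qed
    have aF: "a \<in> {x. (x, x) \<in> F\<^sup>+}" using ab by (simp add: rtrancl_into_trancl2)
    \<comment> \<open>Outside \<open>B\<close> the arcs of \<open>X\<close> belong to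
      \<open>W\<close>, which does not enter \<open>B\<close> and has no cycles. So cycles of
      \<open>X\<close> lie in \<open>B\<close>, and they miss \<open>a\<close>, whose only arc leads
      to \<open>b\<close>.\<close>
    have "{x. (x, x) \<in> X\<^sup>+} \<subseteq> {x. (x, x) \<in> F\<^sup>+} - {a}"
    proof
      fix x assume "x \<in> {x. (x, x) \<in> X\<^sup>+}"
      then have x: "x \<in> B" "(x, x) \<in> (X \<inter> B \<times> B)\<^sup>+"
        using trancl_split[of x x X B] Xno acW[OF XY(2)] by auto
      have "x \<noteq> a"
      proof
        assume "x = a"
        then obtain c where "(a, c) \<in> X \<inter> B \<times> B" using x(2) by (meson tranclD)
        then show False using ab(1) bB F(2) XY(1) by (auto simp: single_valued_def)
      qed
      then show "x \<in> {x. (x, x) \<in> F\<^sup>+} - {a}" using trancl_mono[OF x(2) XY(1)] by auto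
    qed
    then have cX: "card {x. (x, x) \<in> X\<^sup>+} < card {x. (x, x) \<in> F\<^sup>+}"
      using fin aF by (intro psubset_card_mono) auto
    \<comment> \<open>Symmetrically, cycles of \<open>Y\<close> avoid \<open>B\<close> and therefore
      \<open>a\<close>.\<close>
    have "{x. (x, x) \<in> Y\<^sup>+} \<subseteq> {x. (x, x) \<in> F\<^sup>+} - {a}"
    proof
      fix x assume "x \<in> {x. (x, x) \<in> Y\<^sup>+}"
      then have x: "x \<notin> B" "(x, x) \<in> (Y \<inter> (- B) \<times> (- B))\<^sup>+"
        using trancl_split[of x x Y "- B"] Yno acW[OF XY(3)] by auto
      then show "x \<in> {x. (x, x) \<in> F\<^sup>+} - {a}" using trancl_mono[OF x(2) XY(4)] aB by auto
    qed
    then have cY: "card {x. (x, x) \<in> Y\<^sup>+} < card {x. (x, x) \<in> F\<^sup>+}"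
      using fin aF by (intro psubset_card_mono) auto
    have WA: "W \<subseteq> Arcs" using SF_D(1)[OF MF_SF[OF W(1)]] .
    have "acyclic (X \<inter> ?S)"
      by (rule acyclic_split[of _ B])
        (use Xno XY(1,2) in \<open>auto intro: acyclic_subset[OF F(3)] acyclic_subset[OF W.acyclic]\<close>)
    then have "min_weight k + slope k * real k \<le> cost (slope k) X"
      by (intro less.hyps[OF cX]) (auto simp: X_def mix_subset F WA single_valued_mix W.functional)
    moreover have "acyclic (Y \<inter> ?S)"
      by (rule acyclic_split'[of _ B])
        (use Yno XY(3,4) in \<open>auto intro: acyclic_subset[OF F(3)] acyclic_subset[OF W.acyclic]\<close>)
    then have "min_weight k + slope k * real k \<le> cost (slope k) Y"
      by (intro less.hyps[OF cY]) (auto simp: Y_def mix_subset F WA single_valued_mix W.functional)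
    moreover have "finite F" using F(1) finite_Arcs finite_subset by blast
    then have "cost (slope k) X + cost (slope k) Y = cost (slope k) F + cost (slope k) W"
      unfolding X_def Y_def using cost_mix W.finite_arcs by blast
    ultimately show ?thesis
      using optimal_MF(2)[OF W(1)] by (simp add: optimal_def)
  qed
qed

text \<open>Both costs are at least the bound and sum to twice the bound. This holds even if one
  result has cycles that pass through several atoms.\<close>

lemma optimal_mix:
  assumes k: "1 \<le> k" "k < card Vs" and F: "optimal k F" and G: "optimal k G"
    and ac: "acyclic (mix A F G \<inter> same_tree (Suc k))" "acyclic (mix A G F \<inter> same_tree (Suc k))"
  shows "optimal k (mix A F G)" "optimal k (mix A G F)"
proof -
  have "finite F" "finite G" using F G finite_Arcs finite_subset by (auto simp: optimal_def)
  moreover have "mix A F G \<subseteq> Arcs" "single_valued (mix A F G)" "mix A G F \<subseteq> Arcs" "single_valued (mix A G F)"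
    using F G by (auto simp: optimal_def mix_subset single_valued_mix)
  ultimately show "optimal k (mix A F G)" "optimal k (mix A G F)"
    using cost_ge[OF k _ _ ac(1)] cost_ge[OF k _ _ ac(2)] cost_mix[of F G "slope k" A] F G
    unfolding optimal_def by linarith+
qed

text \<open>
  A first exchange adds a root q to F. Restricting it to the tree T of F that contains q forces the new
  tree of q to lie inside T, and then a last exchange on that tree alone leaves the other trees of F
  intact.
\<close>

lemma MF_refines:
  assumes F: "F \<in> MF k" and k: "k < card Vs"
  obtains G where "G \<in> MF (Suc k)" "\<And>i j. (i, j) \<in> G \<Longrightarrow> root_of F i = root_of F j"
proof -
  interpret F: finite_forest Vs F using SF_D(4)[OF MF_SF[OF F]] .
  obtain G0 where G0: "G0 \<in> MF (Suc k)" using MF_nonempty[of "Suc k"] k by auto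
  interpret G0: finite_forest Vs G0 using SF_D(4)[OF MF_SF[OF G0]] .
  obtain q where q: "q \<in> roots Vs G0" "roots Vs F \<inter> tree_at Vs G0 q = {}"
    using free_tree_exists[OF MF_SF[OF F] MF_SF[OF G0]] by auto
  define C0 where "C0 = tree_at Vs G0 q"
  have qC0: "q \<in> C0" using G0.roots_tree_at[OF q(1)] by (auto simp: C0_def)
  then have qV: "q \<in> Vs" and qF: "q \<notin> roots Vs F" using q(2) by (auto simp: C0_def tree_at_def)

  define G1 where "G1 = mix C0 G0 F"
  have G1: "G1 \<in> MF (Suc k)"
    unfolding G1_def C0_def by (rule exchange_free_tree[OF F G0 q])
  interpret G1: finite_forest Vs G1 using SF_D(4)[OF MF_SF[OF G1]] .
  have roots1: "roots Vs G1 = insert q (roots Vs F)"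
    using G0.roots_tree_at[OF q(1)] q(2) unfolding G1_def C0_def roots_mix by auto
  define C1 where "C1 = tree_at Vs G1 q"
  have free1: "roots Vs F \<inter> C1 = {}" and qC1: "q \<in> C1"
    using G1.roots_tree_at[of q] roots1 qF unfolding C1_def by auto
  \<comment> \<open>\<open>C1\<close> may be larger than \<open>C0\<close>, since arcs of
    \<open>F\<close> can lead into \<open>C0\<close>.\<close>
  have "root_of G1 x = root_of G0 x" if "x \<in> C0" for x
    by (rule root_of_agree[OF G0.finite_forest_axioms G1.functional that])
      (use G0.tree_at_closed in \<open>auto simp: C0_def G1_def mix_def\<close>)
  then have C01: "C0 \<subseteq> C1" by (auto simp: C0_def C1_def tree_at_def)
  have agree1: "(i, j) \<in> G1 \<longleftrightarrow> (i, j) \<in> F" if "i \<notin> C1" for i j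
    using that C01 by (auto simp: G1_def mix_def)

  define T where "T = tree_at Vs F (root_of F q)"
  have qT: "q \<in> T" using qV by (simp add: T_def tree_at_def)
  have clT: "i \<in> T \<longleftrightarrow> j \<in> T" if "(i, j) \<in> F" for i j
    using F.tree_at_closed[OF that] by (simp add: T_def)
  have clC1: "i \<in> C1 \<longleftrightarrow> j \<in> C1" if "(i, j) \<in> G1" for i j
    using G1.tree_at_closed[OF that] by (simp add: C1_def)
  define A where "A = C1 \<inter> T"
  \<comment> \<open>Inside \<open>T\<close> no arc of this mix leaves \<open>A\<close>, because arcs
    of \<open>G1\<close> stay in \<open>C1\<close>. For the opposite mix \<open>C1\<close> and
    \<open>T\<close> change roles, as arcs of \<open>F\<close> stay in \<open>T\<close>.\<close>
  have "acyclic (mix A G1 F)"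
  proof (rule acyclic_split[of _ T])
    show "acyclic (mix A G1 F \<inter> T \<times> T)"
      by (rule acyclic_split'[of _ A])
        (use clC1 in \<open>auto simp: A_def mix_def intro: acyclic_subset[OF G1.acyclic] acyclic_subset[OF F.acyclic]\<close>)
  qed (use clT in \<open>auto simp: A_def mix_def intro: acyclic_subset[OF F.acyclic]\<close>)
  moreover have "roots Vs G1 \<inter> A = {q}" "roots Vs F - A = roots Vs F"
    using roots1 free1 qC1 qT by (auto simp: A_def)
  ultimately have G2SF: "mix A G1 F \<in> SF (Suc k)"
    using SF_D(3)[OF MF_SF[OF F]] by (intro mix_SF[OF MF_SF[OF G1] MF_SF[OF F]]) auto
  have "acyclic (mix A F G1)"
  proof (rule acyclic_split[of _ C1])
    show "acyclic (mix A F G1 \<inter> C1 \<times> C1)"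
      by (rule acyclic_split'[of _ A])
        (use clT in \<open>auto simp: A_def mix_def intro: acyclic_subset[OF G1.acyclic] acyclic_subset[OF F.acyclic]\<close>)
  qed (use clC1 in \<open>auto simp: A_def mix_def intro: acyclic_subset[OF G1.acyclic]\<close>)
  moreover have "roots Vs F \<inter> A = {}" "roots Vs G1 - A = roots Vs F"
    using roots1 free1 qC1 qT qF by (auto simp: A_def)
  ultimately have "mix A F G1 \<in> SF k"
    using SF_D(3)[OF MF_SF[OF F]] by (intro mix_SF[OF MF_SF[OF F] MF_SF[OF G1]]) auto
  from exchange(2)[OF F G1 this G2SF] have G2': "mix A G1 F \<in> MF (Suc k)" by simp

  define G2 where "G2 = mix A G1 F"
  have G2: "G2 \<in> MF (Suc k)" using G2' by (simp add: G2_def)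
  interpret G2: finite_forest Vs G2 using SF_D(4)[OF MF_SF[OF G2]] .
  have roots2: "roots Vs G2 = insert q (roots Vs F)"
    using roots1 free1 qC1 qT by (auto simp: G2_def roots_mix A_def)
  define C2 where "C2 = tree_at Vs G2 q"
  have free2: "roots Vs F \<inter> C2 = {}"
    using G2.roots_tree_at[of q] roots2 qF unfolding C2_def by auto
  \<comment> \<open>Outside \<open>T\<close> the arcs of \<open>G2\<close> are those of
    \<open>F\<close>, so a walk starting there never reaches \<open>q\<close>.\<close>
  have C2T: "C2 \<subseteq> T"
  proof
    fix x assume x: "x \<in> C2"
    show "x \<in> T"
    proof (rule ccontr)
      assume "x \<notin> T"
      moreover have "(x, q) \<in> G2\<^sup>*"
        using G2.reach_root_of[of x] x by (simp add: C2_def tree_at_def)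
      ultimately have "q \<in> - T"
        by (intro rtrancl_closed[of x q G2 "- T"]) (use clT in \<open>auto simp: G2_def mix_def A_def\<close>)
      then show False using qT by simp
    qed
  qed
  show ?thesis
  proof (rule that)
    show "mix C2 G2 F \<in> MF (Suc k)"
      unfolding C2_def by (rule exchange_free_tree[OF F G2]) (use roots2 free2 in \<open>auto simp: C2_def\<close>)
    fix i j assume ij: "(i, j) \<in> mix C2 G2 F"
    show "root_of F i = root_of F j"
    proof (cases "i \<in> C2")
      case True
      then have "j \<in> C2" using ij G2.tree_at_closed by (auto simp: C2_def mix_def)
      then have "i \<in> T" "j \<in> T" using True C2T by auto
      then show ?thesis by (simp add: T_def tree_at_def)
    next
      case False
      then show ?thesis using ij F.root_of_arc by (simp add: mix_def)
    qed
  qed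
qed

text \<open>Each tree of the refining forest given by \<open>MF_refines\<close> lies within one tree
  of \<open>F\<close>.\<close>

lemma same_tree_Suc:
  assumes "k < card Vs"
  shows "same_tree (Suc k) \<subseteq> same_tree k"
proof (clarsimp simp: same_tree_def)
  fix x y F
  assume xy: "x \<in> Vs" "y \<in> Vs" "\<forall>F\<in>MF (Suc k). root_of F x = root_of F y" and F: "F \<in> MF k"
  obtain G where G: "G \<in> MF (Suc k)" "\<And>i j. (i, j) \<in> G \<Longrightarrow> root_of F i = root_of F j"
    using MF_refines[OF F assms] by blast
  interpret G: finite_forest Vs G using SF_D(4)[OF MF_SF[OF G(1)]] .
  have "root_of F x = root_of F z" if "(x, z) \<in> G\<^sup>*" for x z
    using that by (induction rule: rtrancl_induct) (use G(2) in auto)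
  then show "root_of F x = root_of F y"
    using xy(3) G(1) G.reach_root_of by metis
qed

section \<open>Atoms at a non-strict level\<close>

text \<open>By flatness the exchange of \<open>P\<close> and \<open>G\<close> gives minimal forests
  of level \<open>Suc j\<close>. One of them preserves the root of every vertex outside the tree of
  \<open>r\<close>, in particular those of \<open>x\<close> and \<open>y\<close>.\<close>

lemma free_tree_separates:
  assumes flat: "min_weight j + min_weight (Suc (Suc j)) \<le> 2 * min_weight (Suc j)"
    and P: "P \<in> MF j" and G: "G \<in> MF (Suc (Suc j))"
    and r: "r \<in> roots Vs G" and free: "roots Vs P \<inter> tree_at Vs G r = {}"
    and xy: "root_of G x \<noteq> r" "root_of G y \<noteq> r" "root_of G x \<noteq> root_of G y"
  shows "(x, y) \<notin> same_tree (Suc j)"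
proof -
  interpret G: finite_forest Vs G using SF_D(4)[OF MF_SF[OF G]] .
  let ?C = "tree_at Vs G r"
  note m = mix_tree_SF[OF MF_SF[OF P] MF_SF[OF G] r free]
  have F: "mix ?C P G \<in> MF (Suc j)"
    by (rule exchange(1)[OF P G m(2,1)]) (use flat in simp)
  have "root_of (mix ?C P G) z = root_of G z" if "root_of G z \<noteq> r" for z
    by (rule root_of_agree[OF G.finite_forest_axioms is_forestD(2)[OF SF_D(2)[OF MF_SF[OF F]]], of _ "- ?C"])
      (use that G.tree_at_closed in \<open>auto simp: mix_def tree_at_def\<close>)
  then show ?thesis using xy by (intro not_same_treeI[OF F]) simp
qed

text \<open>
  Switch to the arcs of G exactly where the P-path meets an atom visited by the G-path of y.
  Then y still reaches its root in G, whereas x escapes through u to a root of P.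
\<close>

lemma path_exchange_separates:
  assumes j: "1 \<le> j" "Suc (Suc j) \<le> card Vs"
    and flat: "min_weight j + min_weight (Suc (Suc j)) \<le> 2 * min_weight (Suc j)"
    and P: "P \<in> MF j" and G: "G \<in> MF (Suc (Suc j))"
    and xy: "x \<in> Vs" "y \<in> Vs" "root_of G x \<noteq> root_of G y"
    and U: "U = tree_at Vs G (root_of G x) \<union> tree_at Vs G (root_of G y)"
    and agree: "\<And>a b. a \<notin> U \<Longrightarrow> (a, b) \<in> P \<longleftrightarrow> (a, b) \<in> G"
    and rootsP: "roots Vs P = roots Vs G - {root_of G x, root_of G y}"
    and u: "(x, x') \<in> G\<^sup>*" "(x', u) \<in> same_tree (Suc (Suc j))"
    and avoid: "\<And>z z'. (y, z) \<in> G\<^sup>* \<Longrightarrow> (z, z') \<in> same_tree (Suc (Suc j)) \<Longrightarrow> (u, z') \<notin> P\<^sup>*"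
  shows "(x, y) \<notin> same_tree (Suc j)"
proof -
  let ?S = "same_tree (Suc (Suc j))"
  interpret G: finite_forest Vs G using SF_D(4)[OF MF_SF[OF G]] .
  interpret P: finite_forest Vs P using SF_D(4)[OF MF_SF[OF P]] .
  define qx where "qx = root_of G x"
  define qy where "qy = root_of G y"
  define Y where "Y = ?S `` {z. (y, z) \<in> G\<^sup>*}"
  define T where "T = {w. \<exists>z\<in>Y. (w, z) \<in> P\<^sup>*}"
  have uV: "u \<in> Vs" using u(2) by (simp add: same_tree_def)
  have uT: "u \<notin> T" using avoid by (auto simp: T_def Y_def)
  have pathY: "z \<in> Y" if "(y, z) \<in> G\<^sup>*" for z
    using that G.reach_in_vertices[OF that xy(2)] by (auto simp: Y_def same_tree_def)
  have YT: "Y \<subseteq> T" by (auto simp: T_def)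
  have qs: "qx \<in> roots Vs G" "qy \<in> roots Vs G" "qx \<noteq> qy"
    using G.root_of_in_roots xy by (auto simp: qx_def qy_def)
  have Yqy: "Y \<subseteq> tree_at Vs G qy"
  proof
    fix z' assume "z' \<in> Y"
    then obtain z where "(y, z) \<in> G\<^sup>*" "(z, z') \<in> ?S" by (auto simp: Y_def)
    then show "z' \<in> tree_at Vs G qy"
      using G G.root_of_reach[of y z] by (auto simp: same_tree_def tree_at_def qy_def)
  qed
  have clU: "a \<in> U \<longleftrightarrow> b \<in> U" if "(a, b) \<in> G" for a b
    using G.tree_at_closed[OF that] by (auto simp: U)
  have TU: "T \<subseteq> U"
  proof
    fix w assume "w \<in> T"
    then obtain z where z: "z \<in> Y" "(w, z) \<in> P\<^sup>*" by (auto simp: T_def)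
    show "w \<in> U"
    proof (rule ccontr)
      assume "w \<notin> U"
      then have "z \<in> - U"
        by (intro rtrancl_closed[OF z(2)]) (use agree clU in auto)
      then show False using z(1) Yqy by (auto simp: U qy_def)
    qed
  qed
  have GU: "roots Vs G \<inter> U = {qx, qy}"
    using G.roots_tree_at[OF qs(1)] G.roots_tree_at[OF qs(2)] by (auto simp: U qx_def qy_def)
  have PT: "roots Vs P \<inter> T = {}"
    using GU TU rootsP by (auto simp: qx_def qy_def)
  have qyT: "qy \<in> T" using pathY[OF G.reach_root_of] YT by (auto simp: qy_def)
  have GT: "roots Vs G \<inter> T = {qy} \<union> ({qx} \<inter> T)"
    using GU TU qyT qs by blast

  define J where "J = mix T G P"
  have acJ: "acyclic J"
    unfolding J_def
    by (rule acyclic_mix_no_entry[OF G.acyclic P.acyclic])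
      (auto simp: T_def intro: converse_rtrancl_into_rtrancl)
  \<comment> \<open>An arc of \<open>P\<close> leaves \<open>T\<close> only from a vertex of
    \<open>Y\<close> whose walk does not meet \<open>Y\<close> again. If it stayed within an atom,
    its head would be in \<open>Y\<close>; so it joins two atoms.\<close>
  have "acyclic (mix T P G \<inter> ?S)"
  proof (rule acyclic_split'[of _ T])
    fix a b assume ab: "(a, b) \<in> mix T P G \<inter> ?S" "a \<in> T"
    then obtain z where z: "z \<in> Y" "(a, z) \<in> P\<^sup>*" and abP: "(a, b) \<in> P" by (auto simp: T_def mix_def)
    show "b \<in> T"
    proof (cases "a = z")
      case True
      then have "b \<in> Y" using z(1) ab(1) unfolding Y_def same_tree_def by fastforce
      then show ?thesis using YT by blast
    next
      case False
      then obtain c where "(a, c) \<in> P" "(c, z) \<in> P\<^sup>*" using z(2) by (metis converse_rtranclE)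
      then show ?thesis using abP P.functional z(1) by (auto simp: T_def single_valued_def)
    qed
  qed (auto simp: mix_def intro: acyclic_subset[OF P.acyclic] acyclic_subset[OF G.acyclic])
  \<comment> \<open>Flatness puts the three levels on one line, so \<open>P\<close> attains the same
    cost from level \<open>j\<close>.\<close>
  moreover have "optimal (Suc j) P"
  proof -
    have "2 * min_weight (Suc j) = min_weight j + min_weight (Suc (Suc j))"
      using flat min_weight_convex[of j] j by simp
    then have "cost (slope (Suc j)) P = min_weight (Suc j) + slope (Suc j) * real (Suc j)"
      by (simp add: cost_MF[OF P] slope_def algebra_simps)
    then show ?thesis
      using P.functional SF_D(1)[OF MF_SF[OF P]] by (simp add: optimal_def)
  qed
  ultimately have opt: "optimal (Suc j) J"
    unfolding J_def using acJ optimal_MF(2)[OF G] j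
    by (intro optimal_mix) (auto simp: J_def intro: acyclic_subset)
  \<comment> \<open>\<open>T\<close> holds no root of \<open>P\<close> but contributes
    \<open>qy\<close>, and also \<open>qx\<close> if it lies in \<open>T\<close>; this decides the
    level of \<open>J\<close>.\<close>
  have rootsJ: "roots Vs J = roots Vs P \<union> {qy} \<union> ({qx} \<inter> T)"
    using GT PT unfolding J_def roots_mix by blast
  have card: "card (roots Vs G \<inter> T) + card (roots Vs P - T) = (if qx \<in> T then Suc (Suc j) else Suc j)"
    using GT PT qs SF_D(3)[OF MF_SF[OF P]] by (simp add: Diff_triv)
  have JSF: "J \<in> SF (if qx \<in> T then Suc (Suc j) else Suc j)"
    unfolding J_def by (rule mix_SF[OF MF_SF[OF G] MF_SF[OF P]]) (use acJ card in \<open>auto simp: J_def\<close>)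
  then have JMF: "J \<in> MF (if qx \<in> T then Suc (Suc j) else Suc j)"
    by (rule MF_if_optimal[OF _ _ opt]) auto
  interpret J: finite_forest Vs J using SF_D(4)[OF JSF] .

  have Jy: "root_of J y = qy"
    unfolding qy_def
    by (rule root_of_agree[OF G.finite_forest_axioms J.functional, of _ "{z. (y, z) \<in> G\<^sup>*}"])
      (use pathY YT in \<open>auto simp: J_def mix_def\<close>)
  have JnT: "root_of J w \<in> roots Vs P" if "w \<in> Vs" "w \<notin> T" for w
  proof -
    have "root_of J w = root_of P w"
      by (rule root_of_agree[OF P.finite_forest_axioms J.functional, of _ "- T"])
        (use that in \<open>auto simp: J_def mix_def T_def intro: converse_rtrancl_into_rtrancl\<close>)
    then show ?thesis using P.root_of_in_roots[OF that(1)] by simp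
  qed
  \<comment> \<open>\<open>x'\<close> and \<open>u\<close> share an atom of level
    \<open>Suc (Suc j)\<close>, hence a tree of \<open>J\<close> at either possible level.\<close>
  have "root_of J x' = root_of J u"
    using u(2) JMF same_tree_Suc[of "Suc j"] j by (auto simp: same_tree_def split: if_splits)
  then have Jx': "root_of J x' \<in> roots Vs P" using JnT[OF uV uT] by simp
  \<comment> \<open>Backwards along the walk of \<open>G\<close> from \<open>x\<close> to
    \<open>x'\<close>: in \<open>T\<close> the next arc belongs to \<open>J\<close>, and outside
    \<open>T\<close> the root is already known to be one of \<open>P\<close>.\<close>
  have Jx: "root_of J x \<in> roots Vs P"
    using u(1)
  proof (induction rule: converse_rtrancl_induct)
    case (step w w')
    show ?case
    proof (cases "w \<in> T")
      case True
      then have "(w, w') \<in> J" using step by (simp add: J_def mix_def)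
      then show ?thesis using J.root_of_arc step by simp
    next
      case False
      then show ?thesis using JnT step(1) G.arcs_subset by blast
    qed
  qed (rule Jx')
  have nq: "qx \<notin> roots Vs P" "qy \<notin> roots Vs P" using rootsP by (auto simp: qx_def qy_def)
  show ?thesis
  proof (cases "qx \<in> T")
    case False
    then have "J \<in> MF (Suc j)" using JMF by simp
    then show ?thesis using Jx Jy nq by (intro not_same_treeI) auto
  next
    \<comment> \<open>\<open>J\<close> has one tree too many, but the tree of \<open>qx\<close>
      contains no root of \<open>P\<close> and neither \<open>x\<close> nor \<open>y\<close>, so it
      can serve as the free tree.\<close>
    case True
    have free: "roots Vs P \<inter> tree_at Vs J qx = {}"
    proof -
      have "root_of J r = r" if "r \<in> roots Vs P" for r
        using that rootsJ by (intro J.root_of_root) simp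
      then show ?thesis using nq(1) by (auto simp: tree_at_def)
    qed
    have J': "J \<in> MF (Suc (Suc j))" "qx \<in> roots Vs J" using True JMF rootsJ by simp_all
    have "root_of J x \<noteq> qx" "root_of J y \<noteq> qx" "root_of J x \<noteq> root_of J y"
      using Jx Jy nq qs(3) by metis+
    then show ?thesis by (rule free_tree_separates[OF flat P J' free])
  qed
qed

text \<open>For two vertices separated at level \<open>Suc (Suc j)\<close>, a separating minimal
  forest one level below is built with the help of a minimal \<open>j\<close>-forest.\<close>

lemma same_tree_flat:
  assumes j: "1 \<le> j" "Suc (Suc j) \<le> card Vs"
    and flat: "min_weight j + min_weight (Suc (Suc j)) \<le> 2 * min_weight (Suc j)"
  shows "same_tree (Suc j) = same_tree (Suc (Suc j))"
proof
  let ?S = "same_tree (Suc (Suc j))"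
  show "?S \<subseteq> same_tree (Suc j)" using same_tree_Suc j by simp
  have "(x, y) \<notin> same_tree (Suc j)"
    if xy: "x \<in> Vs" "y \<in> Vs" and G: "G \<in> MF (Suc (Suc j))" and ne: "root_of G x \<noteq> root_of G y" for x y G
  proof -
    interpret G: finite_forest Vs G using SF_D(4)[OF MF_SF[OF G]] .
    define qx where "qx = root_of G x"
    define qy where "qy = root_of G y"
    have qs: "qx \<in> roots Vs G" "qy \<in> roots Vs G" "qx \<noteq> qy"
      using G.root_of_in_roots xy ne by (auto simp: qx_def qy_def)
    obtain P0 where P0: "P0 \<in> MF j" using MF_nonempty[of j] j by auto
    show ?thesis
    proof (cases "\<exists>r\<in>roots Vs G - {qx, qy}. roots Vs P0 \<inter> tree_at Vs G r = {}")
      case True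
      then show ?thesis
        using free_tree_separates[OF flat P0 G] ne by (auto simp: qx_def qy_def)
    next
      case False
      \<comment> \<open>Here the \<open>j\<close> roots of \<open>P0\<close> are spread over the
        \<open>j\<close> other trees of \<open>G\<close>, leaving none for the trees of
        \<open>x\<close> and \<open>y\<close>.\<close>
      have sub: "roots Vs G - {qx, qy} \<subseteq> root_of G ` roots Vs P0"
      proof
        fix r assume "r \<in> roots Vs G - {qx, qy}"
        then obtain p where "p \<in> roots Vs P0" "p \<in> tree_at Vs G r" using False by blast
        then show "r \<in> root_of G ` roots Vs P0" by (auto simp: tree_at_def)
      qed
      have cG: "card (roots Vs G - {qx, qy}) = j"
        using qs SF_D(3)[OF MF_SF[OF G]] finite_roots by (subst card_Diff_subset) auto
      have "card (root_of G ` roots Vs P0) \<le> j"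
        using card_image_le[OF finite_roots] SF_D(3)[OF MF_SF[OF P0]] by metis
      then have img: "roots Vs G - {qx, qy} = root_of G ` roots Vs P0"
        using cG by (intro card_seteq[OF finite_imageI[OF finite_roots] sub]) simp
      define U where "U = tree_at Vs G qx \<union> tree_at Vs G qy"
      have PU: "roots Vs P0 \<inter> U = {}" using img by (auto simp: U_def tree_at_def)
      have GU: "roots Vs G \<inter> U = {qx, qy}"
        using G.roots_tree_at[OF qs(1)] G.roots_tree_at[OF qs(2)] by (auto simp: U_def)
      have clU: "a \<in> U \<longleftrightarrow> b \<in> U" if "(a, b) \<in> G" for a b
        using G.tree_at_closed[OF that] by (auto simp: U_def)
      have acP0: "acyclic P0" using is_forestD(3)[OF SF_D(2)[OF MF_SF[OF P0]]] .
      \<comment> \<open>Replacing \<open>P0\<close> by \<open>G\<close> outside \<open>U\<close>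
        makes the two forests differ only on the trees of \<open>x\<close> and
        \<open>y\<close>.\<close>
      define P where "P = mix U P0 G"
      have GmU: "roots Vs G - U = roots Vs G - {qx, qy}" using GU by blast
      have "P \<in> SF j"
        unfolding P_def
        by (rule mix_SF[OF MF_SF[OF P0] MF_SF[OF G] acyclic_mix_no_entry[OF acP0 G.acyclic]])
          (use clU cG PU GmU in auto)
      moreover have "mix U G P0 \<in> SF (Suc (Suc j))"
        by (rule mix_SF[OF MF_SF[OF G] MF_SF[OF P0] acyclic_mix_no_exit[OF G.acyclic acP0]])
          (use clU PU GU qs SF_D(3)[OF MF_SF[OF P0]] in \<open>auto simp: Diff_triv\<close>)
      ultimately have P: "P \<in> MF j"
        unfolding P_def by (intro exchange(1)[OF P0 G]) auto
      interpret P: finite_forest Vs P using SF_D(4)[OF MF_SF[OF P]] .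
      have rootsP: "roots Vs P = roots Vs G - {qx, qy}"
        unfolding P_def roots_mix using PU GU by blast
      have agree: "(a, b) \<in> P \<longleftrightarrow> (a, b) \<in> G" if "a \<notin> U" for a b
        using that by (simp add: P_def mix_def)
      define Q where "Q w = ?S `` {z. (w, z) \<in> G\<^sup>*}" for w
      have "x \<in> Q x \<union> Q y" using xy by (auto simp: Q_def same_tree_def)
      \<comment> \<open>A vertex after which the walk of \<open>P\<close> meets no atom visited from
        \<open>x\<close> or \<open>y\<close>. It belongs to one side only, which then plays the role
        of \<open>x\<close>.\<close>
      then obtain u where u: "u \<in> Q x \<union> Q y" and max: "\<And>z. (u, z) \<in> P\<^sup>+ \<Longrightarrow> z \<notin> Q x \<union> Q y"
        using acyclic_has_maximal[OF P.finite_arcs P.acyclic] by metis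
      have rootQ: "root_of G z = root_of G w" if "z \<in> Q w" for z w
        using that G G.root_of_reach by (fastforce simp: Q_def same_tree_def)
      have main: "(a, b) \<notin> same_tree (Suc j)"
        if ab: "(a, b) = (x, y) \<or> (a, b) = (y, x)" and ua: "u \<in> Q a" for a b
      proof -
        have ub: "u \<notin> Q b" using rootQ[OF ua] rootQ[of u b] ab ne by auto
        have avoid: "(u, z) \<notin> P\<^sup>*" if "z \<in> Q b" for z
          using that ub max[of z] ab by (auto simp: rtrancl_eq_or_trancl)
        obtain x' where x': "(a, x') \<in> G\<^sup>*" "(x', u) \<in> ?S" using ua by (auto simp: Q_def)
        show ?thesis
          by (rule path_exchange_separates[OF j flat P G _ _ _ _ agree _ x'])
            (use ab xy ne avoid rootsP in \<open>auto simp: U_def qx_def qy_def Q_def\<close>)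
      qed
      have "sym (same_tree (Suc j))" by (auto simp: same_tree_def sym_def)
      then show ?thesis using main[of x y] main[of y x] u by (auto dest: symD)
    qed
  qed
  then show "same_tree (Suc j) \<subseteq> ?S" by (fastforce simp: same_tree_def)
qed

section \<open>Trees induced on atoms\<close>

text \<open>
  An induced forest is a tree iff it has exactly one root, here a vertex of E without an arc into E. If F
  has two of them, an exchange produces a minimal (k+1)-forest with two, or one that copies F on E.
\<close>

lemma card_exits_MF:
  assumes k: "1 \<le> k" "k < card Vs" and F: "F \<in> MF k" and e: "e \<in> Vs"
    and E: "E = same_tree (Suc k) `` {e}"
    and tree: "\<And>G. G \<in> MF (Suc k) \<Longrightarrow> card {i \<in> E. \<forall>j\<in>E. (i, j) \<notin> G} = 1"
  shows "card {i \<in> E. \<forall>j\<in>E. (i, j) \<notin> F} = 1"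
proof (rule ccontr)
  assume bad: "card {i \<in> E. \<forall>j\<in>E. (i, j) \<notin> F} \<noteq> 1"
  let ?S = "same_tree (Suc k)"
  interpret F: finite_forest Vs F using SF_D(4)[OF MF_SF[OF F]] .
  have EV: "E \<subseteq> Vs" and eE: "e \<in> E" using e by (auto simp: E same_tree_def)
  have rootE: "root_of G i = root_of G e" if "G \<in> MF (Suc k)" "i \<in> E" for G i
    using that by (auto simp: E same_tree_def)
  have leaveE: "(i, z) \<notin> ?S" if "i \<in> E" "z \<notin> E" for i z
    using that unfolding E same_tree_def by fastforce
  have no_copy: False if "J \<in> MF (Suc k)" "\<And>i j. i \<in> E \<Longrightarrow> (i, j) \<in> J \<longleftrightarrow> (i, j) \<in> F" for J
  proof -
    have "{i \<in> E. \<forall>j\<in>E. (i, j) \<notin> J} = {i \<in> E. \<forall>j\<in>E. (i, j) \<notin> F}" using that(2) by blast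
    then show False using tree[OF that(1)] bad by simp
  qed
  have one_exit: False if J: "J \<in> MF (Suc k)" and "a \<noteq> b" "{a, b} \<subseteq> {i \<in> E. \<forall>j\<in>E. (i, j) \<notin> J}" for J a b
  proof -
    obtain c where "{i \<in> E. \<forall>j\<in>E. (i, j) \<notin> J} = {c}" using tree[OF J] by (rule card_1_singletonE)
    then have "{a, b} \<subseteq> {c}" using that(3) by simp
    then show False using that(2) by simp
  qed
  \<comment> \<open>Exchanging on a free tree other than the one containing \<open>E\<close> would
    leave the arcs of \<open>F\<close> on \<open>E\<close> untouched.\<close>
  have free: "roots Vs F \<inter> tree_at Vs G (root_of G e) = {}" if G: "G \<in> MF (Suc k)" for G
  proof -
    obtain r where r: "r \<in> roots Vs G" "roots Vs F \<inter> tree_at Vs G r = {}"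
      using free_tree_exists[OF MF_SF[OF F] MF_SF[OF G]] by auto
    have "r = root_of G e"
    proof (rule ccontr)
      assume "r \<noteq> root_of G e"
      then have "i \<notin> tree_at Vs G r" if "i \<in> E" for i
        using rootE[OF G that] by (simp add: tree_at_def)
      then show False
        using no_copy[OF exchange_free_tree[OF F G r]] by (simp add: mix_def)
    qed
    then show ?thesis using r by simp
  qed

  obtain G0 where G0: "G0 \<in> MF (Suc k)" using MF_nonempty[of "Suc k"] k by auto
  interpret G0: finite_forest Vs G0 using SF_D(4)[OF MF_SF[OF G0]] .
  define q where "q = root_of G0 e"
  have q0: "q \<in> roots Vs G0" using G0.root_of_in_roots[OF e] by (simp add: q_def)
  have free0: "roots Vs F \<inter> tree_at Vs G0 q = {}" using free[OF G0] by (simp add: q_def)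
  \<comment> \<open>Unlike \<open>G0\<close>, this forest has the roots of \<open>F\<close> and just
    one more, \<open>q\<close>; by \<open>free\<close>, its tree of \<open>q\<close> is again the
    one containing \<open>E\<close>.\<close>
  define G where "G = mix (tree_at Vs G0 q) G0 F"
  have G: "G \<in> MF (Suc k)" unfolding G_def by (rule exchange_free_tree[OF F G0 q0 free0])
  interpret G: finite_forest Vs G using SF_D(4)[OF MF_SF[OF G]] .
  have rootsG: "roots Vs G = insert q (roots Vs F)"
    using G0.roots_tree_at[OF q0] free0 unfolding G_def roots_mix by auto
  have qF: "q \<notin> roots Vs F" using G0.roots_tree_at[OF q0] free0 by auto
  have Ge: "root_of G e = q"
    using free[OF G] G.root_of_in_roots[OF e] G.roots_tree_at[of "root_of G e"] rootsG by auto
  have freeE: "i \<notin> roots Vs F" if "i \<in> E" for i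
    using free[OF G] rootE[OF G that] EV that by (auto simp: tree_at_def)
  obtain p where p: "{i \<in> E. \<forall>j\<in>E. (i, j) \<notin> G} = {p}" using tree[OF G] by (rule card_1_singletonE)
  have pE: "p \<in> E" using p by auto
  \<comment> \<open>The last vertex of \<open>E\<close> on the walk from \<open>i\<close> has no arc
    into \<open>E\<close>, so it is \<open>p\<close>.\<close>
  have to_p: "(i, p) \<in> G\<^sup>*" if "i \<in> E" for i
  proof -
    have "i \<in> {y \<in> E. (i, y) \<in> G\<^sup>*}" using that by simp
    from acyclic_has_maximal[OF G.finite_arcs G.acyclic this]
    obtain y where y: "y \<in> E" "(i, y) \<in> G\<^sup>*" "\<And>z. (y, z) \<in> G\<^sup>+ \<Longrightarrow> z \<in> E \<Longrightarrow> (i, z) \<notin> G\<^sup>*" by auto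
    then have "y \<in> {i \<in> E. \<forall>j\<in>E. (i, j) \<notin> G}"
      by (auto dest: rtrancl_into_rtrancl)
    then show ?thesis using y(2) p by auto
  qed
  show False
  proof (cases "p = q")
    case False
    have pr: "p \<notin> roots Vs G" using G.root_of_root[of p] rootE[OF G pE] Ge False by auto
    then obtain z where z: "(p, z) \<in> G" using pE EV by (auto simp: roots_def)
    then have "z \<notin> E" using p by auto
    then have pz: "(p, z) \<notin> ?S" using leaveE pE by blast
    \<comment> \<open>This subtree contains \<open>E\<close>, and no arc of \<open>G\<close> enters
      it. The opposite mix can have cycles only through \<open>(p, z)\<close>, which joins two
      atoms, so \<open>mix A F G\<close> is minimal and copies \<open>F\<close> on
      \<open>E\<close>.\<close>
    define A where "A = {u. (u, p) \<in> G\<^sup>*}"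
    have ac: "acyclic (mix A F G)"
      by (rule acyclic_mix_no_entry[OF F.acyclic G.acyclic])
        (auto simp: A_def intro: converse_rtrancl_into_rtrancl)
    have "acyclic (mix A G F \<inter> ?S)"
      by (rule acyclic_subset[OF acyclic_mix_subtree[OF G.functional G.acyclic F.acyclic z]])
        (use pz in \<open>auto simp: A_def\<close>)
    then have opt: "optimal k (mix A F G)"
      using ac optimal_MF(1)[OF F] optimal_MF(2)[OF G]
      by (intro optimal_mix[OF k]) (auto intro: acyclic_subset)
    have GA: "roots Vs G \<inter> A = {}"
      using pr by (auto simp: A_def roots_def dest: rtrancl_outside_Domain)
    then have "roots Vs F \<inter> A = {}" "roots Vs G - A = roots Vs G" using rootsG by auto
    then have "mix A F G \<in> SF (Suc k)"
      using SF_D(3)[OF MF_SF[OF G]] by (intro mix_SF[OF MF_SF[OF F] MF_SF[OF G] ac]) auto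
    then have "mix A F G \<in> MF (Suc k)" using MF_if_optimal[OF _ _ opt] by blast
    then show False by (rule no_copy) (use to_p in \<open>auto simp: mix_def A_def\<close>)
  next
    case True
    then have qE: "q \<in> E" using pE by simp
    have qG: "(q, j) \<notin> G" for j using rootsG by (auto simp: roots_def)
    obtain a where a: "a \<in> {i \<in> E. \<forall>j\<in>E. (i, j) \<notin> F}"
      using acyclic_has_maximal[OF F.finite_arcs F.acyclic eE] by auto
    have "{i \<in> E. \<forall>j\<in>E. (i, j) \<notin> F} \<noteq> {a}"
    proof
      assume "{i \<in> E. \<forall>j\<in>E. (i, j) \<notin> F} = {a}"
      then show False using bad by simp
    qed
    then obtain b where "b \<noteq> a" "b \<in> {i \<in> E. \<forall>j\<in>E. (i, j) \<notin> F}"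
      using a by (metis (no_types, lifting) singletonI subsetI subset_antisym singletonD)
    then have ab: "a \<noteq> b" "{a, b} \<subseteq> {i \<in> E. \<forall>j\<in>E. (i, j) \<notin> F}"
      using a by auto
    have "\<not> ((a, b) \<in> F\<^sup>* \<and> (b, a) \<in> F\<^sup>*)"
      using ab(1) F.acyclic by (metis acyclic_def rtranclD rtrancl_trancl_trancl)
    \<comment> \<open>The order is chosen so that \<open>x2\<close> lies outside the subtree
      \<open>T\<close> of \<open>x1\<close>.\<close>
    then obtain x1 x2 where x: "x1 \<noteq> x2" "x1 \<in> E" "x2 \<in> E" "\<And>j. j \<in> E \<Longrightarrow> (x1, j) \<notin> F"
        "\<And>j. j \<in> E \<Longrightarrow> (x2, j) \<notin> F" "(x2, x1) \<notin> F\<^sup>*"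
      using ab that[of a b] that[of b a] by auto
    obtain z where z: "(x1, z) \<in> F" using freeE[OF x(2)] x(2) EV by (auto simp: roots_def)
    have zE: "z \<notin> E" and zV: "z \<in> Vs" using z x(4) F.arcs_subset by auto
    have xz: "(x1, z) \<notin> ?S" using leaveE[OF x(2) zE] .
    define T where "T = {u. (u, x1) \<in> F\<^sup>*}"
    have FT: "roots Vs F \<inter> T = {}"
      using freeE[OF x(2)] by (auto simp: T_def roots_def dest: rtrancl_outside_Domain)
    define H1 where "H1 = mix T G F"
    define H2 where "H2 = mix T F G"
    have ac1: "acyclic H1"
      unfolding H1_def
      by (rule acyclic_mix_no_entry[OF G.acyclic F.acyclic])
        (auto simp: T_def intro: converse_rtrancl_into_rtrancl)
    have ac2: "acyclic (H2 - {(x1, z)})"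
      unfolding H2_def T_def by (rule acyclic_mix_subtree[OF F.functional F.acyclic G.acyclic z])
    have "acyclic (H1 \<inter> ?S)" "acyclic (H2 \<inter> ?S)"
      using acyclic_subset[OF ac1, of "H1 \<inter> ?S"] acyclic_subset[OF ac2, of "H2 \<inter> ?S"] xz by auto
    then have opt: "optimal k H1" "optimal k H2"
      using optimal_mix[OF k optimal_MF(2)[OF G] optimal_MF(1)[OF F], of T]
      by (auto simp: H1_def H2_def)
    show False
    proof (cases "q \<in> T")
      \<comment> \<open>\<open>H1\<close> follows \<open>G\<close> at \<open>q\<close> and
        \<open>F\<close> at \<open>x2\<close>, and so has no arc into \<open>E\<close> from
        either.\<close>
      case True
      then have "roots Vs G \<inter> T = {q}" "roots Vs F - T = roots Vs F" using rootsG FT by auto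
      then have "H1 \<in> SF (Suc k)"
        unfolding H1_def using SF_D(3)[OF MF_SF[OF F]] ac1
        by (intro mix_SF[OF MF_SF[OF G] MF_SF[OF F]]) (auto simp: H1_def)
      then have "H1 \<in> MF (Suc k)" using MF_if_optimal[OF _ _ opt(1)] by blast
      then show False
        by (rule one_exit[of _ q x2]) (use True qE qG x in \<open>auto simp: H1_def mix_def T_def\<close>)
    next
      \<comment> \<open>Now \<open>H1\<close> does not gain the root \<open>q\<close>.
        \<open>H2\<close> has the roots of \<open>G\<close> and no arc into \<open>E\<close> from
        \<open>q\<close> or \<open>x1\<close>, but possibly cycles through \<open>(x1, z)\<close>; a
        forest \<open>P\<close> separating \<open>x1\<close> from \<open>z\<close> breaks
        them.\<close>
      case False
      then obtain P where P: "P \<in> MF (Suc k)" "root_of P x1 \<noteq> root_of P z"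
        using xz x(2) EV zV by (auto simp: same_tree_def)
      interpret P: finite_forest Vs P using SF_D(4)[OF MF_SF[OF P(1)]] .
      define B where "B = tree_at Vs P (root_of P e)"
      have EB: "E \<subseteq> B" using rootE[OF P(1)] EV by (auto simp: B_def tree_at_def)
      have zB: "z \<notin> B" using P rootE[OF P(1) x(2)] by (auto simp: B_def tree_at_def)
      have clB: "i \<in> B \<longleftrightarrow> j \<in> B" if "(i, j) \<in> P" for i j
        using P.tree_at_closed[OF that] by (simp add: B_def)
      define X where "X = mix B H2 P"
      have acX: "acyclic X"
        by (rule acyclic_split[of _ B])
          (use clB zB in \<open>auto simp: X_def mix_def intro: acyclic_subset[OF ac2] acyclic_subset[OF P.acyclic]\<close>)
      have "acyclic (mix B P H2)"
        by (rule acyclic_split'[of _ B])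
          (use clB EB x(2) in \<open>auto simp: mix_def intro: acyclic_subset[OF ac2] acyclic_subset[OF P.acyclic]\<close>)
      then have optX: "optimal k X"
        unfolding X_def using acX opt(2) optimal_MF(2)[OF P(1)]
        by (intro optimal_mix[OF k]) (auto simp: X_def intro: acyclic_subset)
      have "roots Vs H2 = roots Vs G" using FT False rootsG by (auto simp: H2_def roots_mix)
      then have "roots Vs H2 \<inter> B = {q}"
        using rootsG free[OF P(1)] qE EB by (auto simp: B_def)
      moreover have "card (roots Vs P \<inter> B) = 1"
        using P.roots_tree_at[OF P.root_of_in_roots[OF e]] by (simp add: B_def)
      ultimately have "card (roots Vs X) = Suc k"
        using card_roots_split[OF finite_Vs, of P B] SF_D(3)[OF MF_SF[OF P(1)]]
        by (simp add: X_def card_roots_mix[OF finite_Vs])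
      then have "X \<in> SF (Suc k)"
        using acX optX Arcs_subset by (auto simp: SF_iff is_forest_iff optimal_def)
      then have "X \<in> MF (Suc k)" using MF_if_optimal[OF _ _ optX] by blast
      then show False
        by (rule one_exit[of _ q x1])
          (use False qE qG x EB in \<open>auto simp: X_def H2_def mix_def T_def\<close>)
    qed
  qed
qed

section \<open>Atoms as classes of \<open>same_tree\<close>, and the level without arcs\<close>

lemma H_iff:
  "H Vs Arcs v k \<longleftrightarrow>
    (\<forall>F\<in>MF k. \<forall>e\<in>Vs. card {i \<in> same_tree k `` {e}. \<forall>j\<in>same_tree k `` {e}. (i, j) \<notin> F} = 1)"
proof -
  let ?G = "\<Union>F\<in>MF k. components Vs F"
  have comp: "components Vs F = tree_at Vs F ` roots Vs F" if "F \<in> MF k" for F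
    using finite_forest.components_eq[OF SF_D(4)[OF MF_SF[OF that]]] .
  then have sub: "S \<subseteq> Vs" if "S \<in> ?G" for S
    using that by (auto simp: tree_at_def)
  have "{y \<in> Vs. \<forall>S\<in>?G. x \<in> S \<longleftrightarrow> y \<in> S} = same_tree k `` {x}" if x: "x \<in> Vs" for x
  proof -
    have "(\<forall>S\<in>?G. x \<in> S \<longleftrightarrow> y \<in> S) \<longleftrightarrow> (\<forall>F\<in>MF k. root_of F x = root_of F y)" if y: "y \<in> Vs" for y
    proof
      assume L: "\<forall>S\<in>?G. x \<in> S \<longleftrightarrow> y \<in> S"
      show "\<forall>F\<in>MF k. root_of F x = root_of F y"
      proof
        fix F assume F: "F \<in> MF k"
        then have "tree_at Vs F (root_of F x) \<in> ?G"
          using comp[OF F] finite_forest.root_of_in_roots[OF SF_D(4)[OF MF_SF[OF F]] x] by blast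
        then have "y \<in> tree_at Vs F (root_of F x)" using L x by (auto simp: tree_at_def)
        then show "root_of F x = root_of F y" by (simp add: tree_at_def)
      qed
    next
      assume "\<forall>F\<in>MF k. root_of F x = root_of F y"
      then show "\<forall>S\<in>?G. x \<in> S \<longleftrightarrow> y \<in> S" using comp x y by (auto simp: tree_at_def)
    qed
    then show ?thesis using x by (auto simp: same_tree_def)
  qed
  then have atoms: "is_atom (alg Vs Arcs v k) E \<longleftrightarrow> (\<exists>x\<in>Vs. E = same_tree k `` {x})" for E
    unfolding alg_def by (subst atom_gen_algebra_iff[OF finite_Vs sub]) auto
  have classes: "(\<forall>E. (\<exists>x\<in>Vs. E = same_tree k `` {x}) \<longrightarrow> Q E) \<longleftrightarrow> (\<forall>x\<in>Vs. Q (same_tree k `` {x}))" for Q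
    by blast
  have "same_tree k `` {x} \<subseteq> Vs" for x by (auto simp: same_tree_def)
  from is_tree_induced_iff[OF finite_Vs SF_D(2)[OF MF_SF] this] show ?thesis
    unfolding H_def atoms classes by (intro ball_cong refl)
qed

text \<open>With as many trees as vertices there are no arcs and the atoms are singletons; this
  starts the downward induction.\<close>

lemma H_card: "H Vs Arcs v (card Vs)"
  unfolding H_iff
proof (intro ballI)
  fix F e assume F: "F \<in> MF (card Vs)" and e: "e \<in> Vs"
  interpret F: finite_forest Vs F using SF_D(4)[OF MF_SF[OF F]] .
  have "roots Vs F = Vs"
    using SF_D(3)[OF MF_SF[OF F]] finite_Vs by (intro card_subset_eq) (auto simp: roots_def)
  then have "same_tree (card Vs) `` {e} = {e}" "F = {}"
    using e F F.root_of_root F.arcs_subset by (force simp: same_tree_def roots_def)+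
  then show "card {i \<in> same_tree (card Vs) `` {e}. \<forall>j\<in>same_tree (card Vs) `` {e}. (i, j) \<notin> F} = 1"
    by simp
qed

end

theorem theorem1:
  fixes Vs :: "'a set" and Arcs :: "('a \<times> 'a) set" and v :: "'a \<Rightarrow> 'a \<Rightarrow> real"
  assumes "finite Vs"
    and "Arcs \<subseteq> Vs \<times> Vs"
    and "spanning_forests Vs Arcs 1 \<noteq> {}"
    and "\<forall>k. 1 \<le> k \<and> k \<le> card Vs - 1 \<and>
            phi Vs Arcs v (k - 1) - phi Vs Arcs v k > phi Vs Arcs v k - phi Vs Arcs v (k + 1)
            \<longrightarrow> H Vs Arcs v k"
  shows "\<forall>k\<in>{1..card Vs}. H Vs Arcs v k"
proof
  interpret weighted_digraph Vs Arcs v using assms by unfold_locales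
  have phi: "phi Vs Arcs v k = (if k = 0 then \<infinity> else ereal (min_weight k))" for k
    by (simp add: phi_def min_weight_def)
  fix k assume "k \<in> {1..card Vs}"
  then have "k \<le> card Vs" "1 \<le> k" by auto
  then show "H Vs Arcs v k"
  proof (induction k rule: inc_induct)
    case base
    show ?case by (rule H_card)
  next
    case (step k)
    show ?case
    proof (cases "phi Vs Arcs v (k - 1) - phi Vs Arcs v k > phi Vs Arcs v k - phi Vs Arcs v (k + 1)")
      case True
      then show ?thesis using assms(4) step by auto
    next
      case False
      \<comment> \<open>At level 1 the inequality is strict, because \<open>phi\<close> is infinite
        at level 0.\<close>
      then have "k \<noteq> 1" by (auto simp: phi)
      then obtain j where j: "k = Suc j" "1 \<le> j"
        using step.prems by (cases k) auto
      \<comment> \<open>The negated strict inequality, in real numbers, is the flatness that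
        identifies the atoms of levels \<open>k\<close> and \<open>Suc k\<close>.\<close>
      have "min_weight j + min_weight (Suc (Suc j)) \<le> 2 * min_weight (Suc j)"
        using False j by (simp add: phi)
      then have eq: "same_tree k = same_tree (Suc k)"
        using same_tree_flat[of j] j step by simp
      have "H Vs Arcs v (Suc k)" using step by simp
      then show ?thesis
        unfolding H_iff eq using card_exits_MF[of k] step by blast
    qed
  qed
qed
end
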